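(* Let $H=H_n\subseteq K_n$ be a weakly dense sequence of graphs and let $J^{(t)}$, $t=0,1,\dots,M$, be the onion decomposition of $H_n$. If for some $t=t_n\in\{0,1,\dots,M-1\}$ it holds that $$\frac{|V(J^{(t+1)})\setminus V(J^{(t)})|}{|J^{(t+1)}\setminus J^{(t)}|}-\frac{|V(J^{(t)})\setminus V(J^{(t-1)})|}{|J^{(t)}\setminus J^{(t-1)}|}=\Omega\Big(\frac1{\log n}\Big),$$ then for any constant $\delta>0$, if $p=p_n\in(0,1)$ satisfies $$(1+\delta)\,n^{-\frac{|V(J^{(t+1)})\setminus V(J^{(t)})|}{|J^{(t+1)}\setminus J^{(t)}|}}\le p\le(1-\delta)\,n^{-\frac{|V(J^{(t)})\setminus V(J^{(t-1)})|}{|J^{(t)}\setminus J^{(t-1)}|}},$$ it holds that $$\mathrm{MMSE}_n(p)=1-\frac{|J^{(t)}|}{|H|}+o(1).$$ Here, for $t=0$, one sets $J^{(-1)}=\emptyset$ and $0/0=0$ (so $n^{-0/0}=1$). Moreover, for any constant $\delta>0$, if $p\le(1-\delta)\,n^{-\frac{|V(J^{(M)})\setminus V(J^{(M-1)})|}{|J^{(M)}\setminus J^{(M-1)}|}}$, then $\mathrm{MMSE}_n(p)=1-|J^{(M)}|/|H|+o(1)=o(1)$.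
   Context: A graph $T$ on vertex set $[n]$ is identified with its edge set; $|T|$ is its number of edges, $V(T)$ is the set of vertices incident to at least one edge of $T$, and $v(T)=|V(T)|$. Subgraph means subset of edges. A sequence of (nonempty) graphs $H=H_n\subseteq K_n$ is weakly dense if $\liminf_n \frac{|H_n|}{v(H_n)\log v(H_n)}=+\infty$. For graphs $T_2\subseteq T_1$, $\rho(T_1\mid T_2)=\frac{|T_1\setminus T_2|}{|V(T_1)\setminus V(T_2)|}$, with $\rho=+\infty$ when $V(T_1)=V(T_2)$. Onion decomposition of $H$: $J^{(0)}=\emptyset$; for each $t>0$, $J^{(t)}$ is an inclusion-maximal element of $\arg\max_{J:\,J^{(t-1)}\subsetneq J\subseteq H}\rho(J\mid J^{(t-1)})$ (it is unique); stop when $J^{(t)}=H$. $M=M(H)$ is the number of steps until termination, so $J^{(M)}=H$. Planted subgraph model with noise level $p$: $H^*$ is a uniformly random copy of $H_n$ in $K_n$, $G_0\sim G(n,p)$ is independent, and one observes $G=H^*\cup G_0$. Define $$\mathrm{MMSE}_n(p)=\frac1{|H|}\mathbb E\big[\|\mathbf 1_{H^*}-\mathbb E[\mathbf 1_{H^*}\mid G]\|_2^2\big],$$ where $\mathbf 1_{H^*}\in\{0,1\}^{\binom n2}$ is the indicator vector of the edges of $H^*$. Asymptotics are as $n\to\infty$. *)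

theory Defs
  imports "HOL-Probability.Probability"
begin

text \<open>A graph on \<open>{1..n}\<close> is its set of edges, an edge being a two-element set of vertices.\<close>

type_synonym graph = "nat set set"

definition complete_graph :: "nat \<Rightarrow> graph" where
  "complete_graph n = {e. e \<subseteq> {1..n} \<and> card e = 2}"

definition verts :: "graph \<Rightarrow> nat set" where
  "verts T = \<Union>T"

text \<open>Nonemptiness is demanded for \<open>n \<ge> 2\<close> only, because \<open>complete_graph 0\<close> and
  \<open>complete_graph 1\<close> have no edges.\<close>

definition weakly_dense :: "(nat \<Rightarrow> graph) \<Rightarrow> bool" where
  "weakly_dense H \<longleftrightarrow>
     (\<forall>n. H n \<subseteq> complete_graph n) \<and>
     (\<forall>n\<ge>2. H n \<noteq> {}) \<and>
     liminf (\<lambda>n. ereal (real (card (H n)) /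
       (real (card (verts (H n))) * ln (real (card (verts (H n))))))) = \<infinity>"

definition rel_density :: "graph \<Rightarrow> graph \<Rightarrow> ereal" where
  "rel_density T1 T2 =
     (if verts T1 = verts T2 then \<infinity>
      else ereal (real (card (T1 - T2)) / real (card (verts T1 - verts T2))))"

definition densest_extensions :: "graph \<Rightarrow> graph \<Rightarrow> graph set" where
  "densest_extensions H J =
     {J'. J \<subset> J' \<and> J' \<subseteq> H \<and>
          (\<forall>K. J \<subset> K \<and> K \<subseteq> H \<longrightarrow> rel_density K J \<le> rel_density J' J)}"

definition onion_step :: "graph \<Rightarrow> graph \<Rightarrow> graph \<Rightarrow> bool" where
  "onion_step H J J' \<longleftrightarrow>
     J' \<in> densest_extensions H J \<and> \<not> (\<exists>K\<in>densest_extensions H J. J' \<subset> K)"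

text \<open>The inclusion-maximal maximiser is unique, so \<open>SOME\<close> makes no actual choice. After
  termination the sequence is continued by the constant \<open>H\<close>.\<close>

primrec onion :: "graph \<Rightarrow> nat \<Rightarrow> graph" where
  "onion H 0 = {}"
| "onion H (Suc t) =
     (if onion H t = H then H else (SOME J'. onion_step H (onion H t) J'))"

definition onion_length :: "graph \<Rightarrow> nat" where
  "onion_length H = (LEAST t. onion H t = H)"

text \<open>At \<open>t = 0\<close> truncated subtraction and division by zero give the conventions
  \<open>J\<^sup>(\<^sup>-\<^sup>1\<^sup>) = {}\<close> and \<open>0 / 0 = 0\<close>, so the exponent is \<open>0\<close>.\<close>

definition onion_exponent :: "graph \<Rightarrow> nat \<Rightarrow> real" where
  "onion_exponent H t =
     real (card (verts (onion H t) - verts (onion H (t - 1)))) /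
     real (card (onion H t - onion H (t - 1)))"

definition copies :: "nat \<Rightarrow> graph \<Rightarrow> graph set" where
  "copies n H =
     {H'. H' \<subseteq> complete_graph n \<and> (\<exists>f. inj_on f (verts H) \<and> H' = (\<lambda>e. f ` e) ` H)}"

definition erdos_renyi :: "nat \<Rightarrow> real \<Rightarrow> graph pmf" where
  "erdos_renyi n p =
     map_pmf (\<lambda>b. {e \<in> complete_graph n. b e})
       (Pi_pmf (complete_graph n) False (\<lambda>_. bernoulli_pmf p))"

text \<open>The sample space of the planted model consists of the pairs \<open>(H\<^sup>*, G\<^sub>0)\<close>.\<close>

definition planted_model :: "nat \<Rightarrow> graph \<Rightarrow> real \<Rightarrow> (graph \<times> graph) pmf" where
  "planted_model n H p = pair_pmf (pmf_of_set (copies n H)) (erdos_renyi n p)"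

definition observed :: "graph \<times> graph \<Rightarrow> graph" where
  "observed \<omega> = fst \<omega> \<union> snd \<omega>"

text \<open>The \<open>\<sigma>\<close>-algebra generated by the observed graph.\<close>

definition observed_algebra :: "(graph \<times> graph) measure" where
  "observed_algebra = vimage_algebra UNIV observed (count_space UNIV)"

definition planted_edge :: "nat set \<Rightarrow> graph \<times> graph \<Rightarrow> real" where
  "planted_edge e \<omega> = indicator (fst \<omega>) e"

definition MMSE :: "nat \<Rightarrow> graph \<Rightarrow> real \<Rightarrow> real" where
  "MMSE n H p = 1 / real (card H) *
     measure_pmf.expectation (planted_model n H p)
       (\<lambda>\<omega>. \<Sum>e\<in>complete_graph n.
          (planted_edge e \<omega> -
           real_cond_exp (measure_pmf (planted_model n H p)) observed_algebra
             (planted_edge e) \<omega>)\<^sup>2)"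

lemma onion_step_exists:
  assumes "finite H" "J \<subset> H"
  shows "\<exists>J'. onion_step H J J'"
proof -
  define C where "C = {J'. J \<subset> J' \<and> J' \<subseteq> H}"
  have fin: "finite C"
    using assms(1) by (auto simp: C_def intro: finite_subset[of _ "Pow H"])
  have "C \<noteq> {}"
    using assms by (auto simp: C_def)
  then have "Max ((\<lambda>K. rel_density K J) ` C) \<in> (\<lambda>K. rel_density K J) ` C"
    using fin by (intro Max_in) auto
  then obtain J' where "J' \<in> C" "rel_density J' J = Max ((\<lambda>K. rel_density K J) ` C)"
    by auto
  then have "J' \<in> C" "\<forall>K\<in>C. rel_density K J \<le> rel_density J' J"
    using fin by auto
  then have "J' \<in> densest_extensions H J"
    by (auto simp: densest_extensions_def C_def)
  moreover have "finite (densest_extensions H J)"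
    by (rule finite_subset[OF _ fin]) (auto simp: densest_extensions_def C_def)
  ultimately obtain K where "K \<in> densest_extensions H J"
    "\<forall>L\<in>densest_extensions H J. K \<subseteq> L \<longrightarrow> K = L"
    using finite_has_maximal2 by metis
  then show ?thesis
    unfolding onion_step_def by blast
qed

lemma onion_subset:
  assumes "finite H"
  shows "onion H t \<subseteq> H"
    and "onion H t \<noteq> H \<Longrightarrow> onion_step H (onion H t) (onion H (Suc t))"
proof -
  have step: "onion_step H (onion H t) (onion H (Suc t))"
    if "onion H t \<subseteq> H" "onion H t \<noteq> H" for t
    using someI_ex[OF onion_step_exists[OF assms, of "onion H t"]] that by auto
  show *: "onion H t \<subseteq> H"
  proof (induction t)
    case (Suc t)
    then show ?case
      using step[of t] unfolding onion_step_def densest_extensions_def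
      by (cases "onion H t = H") (simp, blast)
  qed simp
  show "onion H t \<noteq> H \<Longrightarrow> onion_step H (onion H t) (onion H (Suc t))"
    using step * by blast
qed

lemma onion_terminates:
  assumes "finite H"
  shows "onion H (onion_length H) = H"
proof -
  have "onion H t = H \<or> t \<le> card (onion H t)" for t
  proof (induction t)
    case (Suc t)
    show ?case
    proof (cases "onion H t = H")
      case False
      then have "onion H t \<subset> onion H (Suc t)"
        using onion_subset(2)[OF assms] by (auto simp: onion_step_def densest_extensions_def)
      then have "card (onion H t) < card (onion H (Suc t))"
        using onion_subset(1)[OF assms] assms by (meson finite_subset psubset_card_mono)
      then show ?thesis
        using Suc False by linarith
    qed simp
  qed simp
  from this[of "Suc (card H)"] have "onion H (Suc (card H)) = H"
    using card_mono[OF assms onion_subset(1)[OF assms, of "Suc (card H)"]] by linarith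
  then show ?thesis
    unfolding onion_length_def by (rule LeastI)
qed

end

theory Submission
  imports Defs
begin

text \<open>The posterior law of \<open>H\<^sup>*\<close> given \<open>G\<close> is uniform on the copies of \<open>H\<close> contained in \<open>G\<close>, so the
  MMSE is one minus the mean normalised overlap of \<open>H\<^sup>*\<close> with such a copy. By submodularity of
  \<open>v\<close>, the layer \<open>J = J\<^sup>(\<^sup>t\<^sup>)\<close> minimises \<open>v(S) - a |S|\<close> over \<open>S \<subseteq> H\<close> for every slope \<open>a\<close> between two
  consecutive exponents. Hence, for \<open>p\<close> below the upper threshold, the expected number of copies
  of \<open>J\<close> in \<open>G\<close> whose overlap with \<open>H\<^sup>*\<close> is less than \<open>|J| - \<epsilon> |H|\<close> tends to zero, and for \<open>p\<close> above
  the lower threshold the expected number of copies of \<open>H\<close>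
  whose overlap with \<open>H\<^sup>*\<close> exceeds \<open>|J| + \<epsilon> |H|\<close> is exponentially smaller in \<open>|H|\<close> than
  \<open>p^(|H| - |J|) n^(v(H) - v(J))\<close>, while a change of measure shows that the total number of copies
  is rarely that small. All entropy factors are of the form \<open>v(H)^O(v(H))\<close>, which is subexponential
  in \<open>|H|\<close> by weak density.\<close>

subsection \<open>The onion decomposition\<close>

lemma verts_mono: "S \<subseteq> T \<Longrightarrow> verts S \<subseteq> verts T"
  by (auto simp: verts_def)

lemma finite_verts_subset: "S \<subseteq> T \<Longrightarrow> finite (verts T) \<Longrightarrow> finite (verts S)"
  by (rule finite_subset[OF verts_mono])

declare onion.simps(2) [simp del]

lemma real_card_Diff:
  assumes "A \<subseteq> B" "finite B"
  shows "real (card (B - A)) = real (card B) - real (card A)"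
  using card_Diff_subset[OF finite_subset[OF assms] assms(1)] card_mono[OF assms(2,1)]
  by (simp add: of_nat_diff)

text \<open>A vertex of \<open>S \<inter> T\<close> lies in both vertex sets, while a common vertex
  of \<open>S\<close> and \<open>T\<close> need not lie on a common edge. This inequality is what
  allows a subgraph to be uncrossed against an onion layer.\<close>

lemma card_verts_submodular:
  assumes "finite (verts S)" "finite (verts T)"
  shows "card (verts (S \<union> T)) + card (verts (S \<inter> T)) \<le> card (verts S) + card (verts T)"
proof -
  have "card (verts (S \<inter> T)) \<le> card (verts S \<inter> verts T)"
    using assms by (intro card_mono) (auto simp: verts_def)
  moreover have "verts (S \<union> T) = verts S \<union> verts T"
    by (auto simp: verts_def)
  ultimately show ?thesis
    using card_Un_Int[OF assms] by simp
qed

lemma onion_psubset: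
  assumes "finite H" "onion H t \<noteq> H"
  shows "onion H t \<subset> onion H (Suc t)"
  using onion_subset(2)[OF assms] by (simp add: onion_step_def densest_extensions_def)

lemma onion_mono_Suc: "finite H \<Longrightarrow> onion H t \<subseteq> onion H (Suc t)"
  using onion_psubset by (cases "onion H t = H") (auto simp: onion.simps(2))

lemma onion_neq: "t < onion_length H \<Longrightarrow> onion H t \<noteq> H"
  unfolding onion_length_def by (rule not_less_Least)

text \<open>Clearing the denominator keeps the identity valid after termination, where the new layer
  is empty and both sides are 0. Exponents thereby act as slopes between the points formed by edge
  count and vertex count.\<close>

lemma onion_exponent_mult:
  assumes "finite H" "finite (verts H)"
  shows "onion_exponent H (Suc t) * (real (card (onion H (Suc t))) - real (card (onion H t))) =
    real (card (verts (onion H (Suc t)))) - real (card (verts (onion H t)))"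
proof -
  define J J' where "J = onion H t" and "J' = onion H (Suc t)"
  have sub: "J \<subseteq> J'" "J' \<subseteq> H"
    using onion_mono_Suc[OF assms(1)] onion_subset(1)[OF assms(1)] by (simp_all add: J_def J'_def)
  then have fin: "finite J'" "finite (verts J')"
    by (auto intro: finite_subset[OF _ assms(1)] finite_verts_subset[OF _ assms(2)])
  have 1: "real (card (J' - J)) = real (card J') - real (card J)"
    using sub fin by (intro real_card_Diff)
  have 2: "real (card (verts J' - verts J)) = real (card (verts J')) - real (card (verts J))"
    using sub fin by (intro real_card_Diff verts_mono)
  show ?thesis
  proof (cases "J' = J")
    case False
    then have "card (J' - J) \<noteq> 0" using sub fin by auto
    then show ?thesis using 1 2
      by (simp add: onion_exponent_def J_def[symmetric] J'_def[symmetric])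
  qed (simp add: J_def J'_def)
qed

lemma le_mult_of_divide_le:
  fixes x y a b :: real
  assumes "x / y \<le> a / b" "y > 0" "b > 0" "a > 0"
  shows "b / a * x \<le> y"
  using assms by (simp add: field_simps)

text \<open>The exponent is the reciprocal of the maximal density over the current layer, read as 0
  when that density is infinite. So no competitor \<open>K\<close> adds fewer vertices per edge than
  the layer chosen by the onion step.\<close>

lemma onion_exponent_mult_le:
  assumes "finite H" "finite (verts H)" "onion H t \<noteq> H" "onion H t \<subseteq> K" "K \<subseteq> H"
  shows "onion_exponent H (Suc t) * (real (card K) - real (card (onion H t))) \<le>
    real (card (verts K)) - real (card (verts (onion H t)))"
proof (cases "K = onion H t")
  case False
  define J J' where "J = onion H t" and "J' = onion H (Suc t)"
  have J': "J \<subset> J'" "J' \<subseteq> H"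
    using onion_psubset[OF assms(1,3)] onion_subset(1)[OF assms(1)] by (simp_all add: J_def J'_def)
  have "J \<subset> K" using False assms by (auto simp: J_def)
  then have dens: "rel_density K J \<le> rel_density J' J"
    using onion_subset(2)[OF assms(1,3)] assms(5)
    unfolding onion_step_def densest_extensions_def J_def J'_def by blast
  have fin: "finite J'" "finite (verts J')" "finite K" "finite (verts K)"
    using assms(5) J' by (auto intro: finite_subset[OF _ assms(1)] finite_verts_subset[OF _ assms(2)])
  have cK: "real (card (K - J)) = real (card K) - real (card J)"
    using \<open>J \<subset> K\<close> fin by (intro real_card_Diff) auto
  have vK: "real (card (verts K - verts J)) = real (card (verts K)) - real (card (verts J))"
    using \<open>J \<subset> K\<close> fin by (intro real_card_Diff verts_mono) auto
  have e: "onion_exponent H (Suc t) = real (card (verts J' - verts J)) / real (card (J' - J))"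
    by (simp add: onion_exponent_def J_def J'_def)
  have "onion_exponent H (Suc t) * real (card (K - J)) \<le> real (card (verts K - verts J))"
  \<comment> \<open>If the step adds no vertex, the exponent is 0 and the claim is trivial.
    Otherwise the maximal density is finite, hence so is that of \<open>K\<close>, and the two
    compare as real quotients.\<close>
  proof (cases "verts J' = verts J")
    case False
    then have "rel_density K J \<noteq> \<infinity>"
      using dens by (simp add: rel_density_def split: if_splits)
    then have neq: "verts K \<noteq> verts J"
      by (simp add: rel_density_def split: if_splits)
    then have le: "real (card (K - J)) / real (card (verts K - verts J)) \<le>
        real (card (J' - J)) / real (card (verts J' - verts J))"
      using dens False neq by (simp add: rel_density_def)
    have "\<not> verts K \<subseteq> verts J" "\<not> verts J' \<subseteq> verts J" "\<not> J' \<subseteq> J"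
      using neq False J' \<open>J \<subset> K\<close> verts_mono[of J K] verts_mono[of J J'] by blast+
    then have "card (verts K - verts J) > 0" "card (verts J' - verts J) > 0" "card (J' - J) > 0"
      using fin by (simp_all add: card_gt_0_iff)
    then show ?thesis
      unfolding e by (intro le_mult_of_divide_le[OF le]) auto
  qed (simp add: e)
  then show ?thesis using cK vK by (simp add: J_def)
qed simp

text \<open>Two consecutive layers together compete in the earlier of the two maximisations.
  Subtracting the exact identity for the earlier layer leaves the comparison of slopes on the later
  one.\<close>

lemma onion_exponent_mono:
  assumes "finite H" "finite (verts H)" "onion H t \<noteq> H"
  shows "onion_exponent H t \<le> onion_exponent H (Suc t)"
proof (cases t)
  case 0
  then show ?thesis by (simp add: onion_exponent_def)
next
  case (Suc s)
  \<comment> \<open>The sequence is constant once it has reached \<open>H\<close>, so the earlier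
    term is a proper subgraph as well.\<close>
  have neq: "onion H s \<noteq> H" using assms(3) Suc by (metis onion.simps(2))
  define a b c where "a = real (card (onion H s))" and "b = real (card (onion H (Suc s)))"
    and "c = real (card (onion H (Suc (Suc s))))"
  define u v w where "u = real (card (verts (onion H s)))"
    and "v = real (card (verts (onion H (Suc s))))"
    and "w = real (card (verts (onion H (Suc (Suc s)))))"
  note defs = a_def b_def c_def u_def v_def w_def
  have "onion_exponent H (Suc s) * (c - a) \<le> w - u"
    unfolding defs
    by (intro onion_exponent_mult_le assms neq onion_subset(1)
      order_trans[OF onion_mono_Suc onion_mono_Suc])
  moreover have "onion_exponent H (Suc s) * (b - a) = v - u"
    unfolding defs by (rule onion_exponent_mult[OF assms(1,2)])
  moreover have "onion_exponent H (Suc (Suc s)) * (c - b) = w - v"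
    unfolding defs by (rule onion_exponent_mult[OF assms(1,2)])
  ultimately have "onion_exponent H (Suc s) * (c - b) \<le> onion_exponent H (Suc (Suc s)) * (c - b)"
    by (smt (verit) right_diff_distrib)
  moreover have "b < c"
    using psubset_card_mono[OF finite_subset[OF onion_subset(1)[OF assms(1)] assms(1)]
      onion_psubset[OF assms(1,3)]] Suc unfolding defs by simp
  ultimately show ?thesis using Suc by simp
qed

text \<open>Induction on \<open>t\<close>, uncrossing \<open>S\<close> with the previous term
  \<open>J\<close>: the induction hypothesis handles \<open>S \<inter> J\<close>, greedy optimality
  handles \<open>S \<union> J\<close>, and submodularity adds the two. The bound on \<open>t\<close>
  makes every earlier term a proper subgraph of \<open>H\<close>.\<close>

lemma onion_upper:
  assumes "finite H" "finite (verts H)" "t \<le> onion_length H" "S \<subseteq> onion H t"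
  shows "real (card (verts (onion H t))) - real (card (verts S)) \<le>
    onion_exponent H t * (real (card (onion H t)) - real (card S))"
  using assms(3,4)
proof (induction t arbitrary: S)
  case (Suc t)
  define J J' where "J = onion H t" and "J' = onion H (Suc t)"
  have neq: "J \<noteq> H" unfolding J_def using Suc.prems by (intro onion_neq) simp
  have sub: "J \<subseteq> J'" "J' \<subseteq> H" "S \<subseteq> J'"
    using onion_mono_Suc[OF assms(1)] onion_subset(1)[OF assms(1)] Suc.prems
    by (simp_all add: J_def J'_def)
  then have "J \<subseteq> H" "S \<subseteq> H" by auto
  then have fin: "finite J" "finite S" "finite (verts J)" "finite (verts S)"
    by (auto intro: finite_subset[OF _ assms(1)] finite_verts_subset[OF _ assms(2)])
  have mono: "onion_exponent H t \<le> onion_exponent H (Suc t)"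
    using onion_exponent_mono neq assms by (simp add: J_def)
  have card: "real (card (S \<union> J)) + real (card (S \<inter> J)) = real (card S) + real (card J)"
    using card_Un_Int[OF fin(2,1)] by simp
  have sm: "real (card (verts (S \<union> J))) + real (card (verts (S \<inter> J))) \<le>
      real (card (verts S)) + real (card (verts J))"
    using card_verts_submodular[OF fin(4,3)] by simp
  have "real (card (verts J)) - real (card (verts (S \<inter> J))) \<le>
      onion_exponent H t * (real (card J) - real (card (S \<inter> J)))"
    unfolding J_def using Suc.prems by (intro Suc.IH) auto
  \<comment> \<open>The slope may be raised because \<open>S \<inter> J\<close> has at most as many
    edges as \<open>J\<close>.\<close>
  also have "\<dots> \<le> onion_exponent H (Suc t) * (real (card J) - real (card (S \<inter> J)))"
    using mono fin by (intro mult_right_mono) (auto intro: card_mono)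
  finally have 1: "real (card (verts J)) - real (card (verts (S \<inter> J))) \<le> \<dots>" .
  have 2: "onion_exponent H (Suc t) * (real (card (S \<union> J)) - real (card J)) \<le>
      real (card (verts (S \<union> J))) - real (card (verts J))"
    unfolding J_def using assms neq \<open>S \<subseteq> H\<close> \<open>J \<subseteq> H\<close>
    by (intro onion_exponent_mult_le) (auto simp: J_def)
  have 3: "onion_exponent H (Suc t) * (real (card J') - real (card J)) =
      real (card (verts J')) - real (card (verts J))"
    unfolding J_def J'_def by (rule onion_exponent_mult[OF assms(1,2)])
  \<comment> \<open>Edge counts are modular, so the difference from \<open>S\<close> to
    \<open>J'\<close> splits exactly into three differences, each controlled above.\<close>
  have "onion_exponent H (Suc t) * (real (card J') - real (card S)) =
      onion_exponent H (Suc t) * (real (card J') - real (card J)) -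
      onion_exponent H (Suc t) * (real (card (S \<union> J)) - real (card J)) +
      onion_exponent H (Suc t) * (real (card J) - real (card (S \<inter> J)))"
    unfolding left_diff_distrib[symmetric] distrib_left[symmetric] right_diff_distrib[symmetric]
    using card by (intro arg_cong2[where f="(*)"]) auto
  then show ?case
    using 1 2 3 sm unfolding J_def[symmetric] J'_def[symmetric] by linarith
qed simp

text \<open>The same uncrossing, now for arbitrary \<open>S\<close> in \<open>H\<close> and with the
  exponent of the next layer: \<open>onion_upper\<close> with raised slope controls the part of
  \<open>S\<close> inside the current term, and the greedy choice of the next layer controls the
  part beyond it.\<close>

lemma onion_lower:
  assumes "finite H" "finite (verts H)" "t < onion_length H" "S \<subseteq> H"
  shows "onion_exponent H (Suc t) * (real (card S) - real (card (onion H t))) \<le>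
    real (card (verts S)) - real (card (verts (onion H t)))"
proof -
  define J where "J = onion H t"
  have neq: "J \<noteq> H" unfolding J_def using assms by (intro onion_neq) simp
  have "J \<subseteq> H" using onion_subset(1) assms by (simp add: J_def)
  then have fin: "finite J" "finite S" "finite (verts J)" "finite (verts S)"
    using assms(4) by (auto intro: finite_subset[OF _ assms(1)] finite_verts_subset[OF _ assms(2)])
  have card: "real (card (S \<union> J)) + real (card (S \<inter> J)) = real (card S) + real (card J)"
    using card_Un_Int[OF fin(2,1)] by simp
  have sm: "real (card (verts (S \<union> J))) + real (card (verts (S \<inter> J))) \<le>
      real (card (verts S)) + real (card (verts J))"
    using card_verts_submodular[OF fin(4,3)] by simp
  have "real (card (verts J)) - real (card (verts (S \<inter> J))) \<le>
      onion_exponent H t * (real (card J) - real (card (S \<inter> J)))"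
    unfolding J_def using assms by (intro onion_upper) auto
  also have "\<dots> \<le> onion_exponent H (Suc t) * (real (card J) - real (card (S \<inter> J)))"
    using onion_exponent_mono[OF assms(1,2), of t] neq fin
    by (intro mult_right_mono) (auto intro: card_mono simp: J_def)
  finally have 1: "real (card (verts J)) - real (card (verts (S \<inter> J))) \<le> \<dots>" .
  have 2: "onion_exponent H (Suc t) * (real (card (S \<union> J)) - real (card J)) \<le>
      real (card (verts (S \<union> J))) - real (card (verts J))"
    unfolding J_def using assms neq \<open>J \<subseteq> H\<close>
    by (intro onion_exponent_mult_le) (auto simp: J_def)
  have "onion_exponent H (Suc t) * (real (card S) - real (card J)) =
      onion_exponent H (Suc t) * (real (card (S \<union> J)) - real (card J)) -
      onion_exponent H (Suc t) * (real (card J) - real (card (S \<inter> J)))"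
    unfolding right_diff_distrib[symmetric]
    using card by (intro arg_cong2[where f="(*)"]) auto
  then show ?thesis
    using 1 2 sm unfolding J_def[symmetric] by linarith
qed

subsection \<open>Embeddings and the planted model\<close>

text \<open>Extensional functions are used so that each injection of the vertex set is counted once
  and the set is finite.\<close>

definition embeddings :: "nat \<Rightarrow> graph \<Rightarrow> (nat \<Rightarrow> nat) set" where
  "embeddings n T = {f \<in> verts T \<rightarrow>\<^sub>E {1..n}. inj_on f (verts T)}"

definition graph_map :: "(nat \<Rightarrow> nat) \<Rightarrow> graph \<Rightarrow> graph" where
  "graph_map f T = (\<lambda>e. f ` e) ` T"

lemma finite_complete_graph [simp]: "finite (complete_graph n)"
  by (rule finite_subset[of _ "Pow {1..n}"]) (auto simp: complete_graph_def)

lemma verts_complete_graph: "T \<subseteq> complete_graph n \<Longrightarrow> verts T \<subseteq> {1..n}"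
  by (auto simp: complete_graph_def verts_def)

lemma finite_verts: "T \<subseteq> complete_graph n \<Longrightarrow> finite (verts T)"
  by (rule finite_subset[OF verts_complete_graph]) auto

lemma edge_subset_verts: "e \<in> T \<Longrightarrow> e \<subseteq> verts T"
  by (auto simp: verts_def)

lemma card_graph_map: "inj_on f (verts T) \<Longrightarrow> card (graph_map f T) = card T"
  unfolding graph_map_def by (rule card_image) (simp add: inj_on_image verts_def)

lemma verts_graph_map: "verts (graph_map f T) = f ` verts T"
  by (auto simp: verts_def graph_map_def)

lemma graph_map_cong: "(\<And>v. v \<in> verts T \<Longrightarrow> f v = g v) \<Longrightarrow> graph_map f T = graph_map g T"
  unfolding graph_map_def by (intro image_cong refl) (use edge_subset_verts in blast)

lemma graph_map_mono: "S \<subseteq> T \<Longrightarrow> graph_map f S \<subseteq> graph_map f T"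
  by (auto simp: graph_map_def)

lemma finite_embeddings [simp]:
  assumes "finite (verts T)"
  shows "finite (embeddings n T)"
  by (rule finite_subset[of _ "verts T \<rightarrow>\<^sub>E {1..n}"])
    (auto simp: embeddings_def intro!: finite_PiE assms)

lemma graph_map_subset:
  assumes "T \<subseteq> complete_graph m" "f \<in> embeddings n T"
  shows "graph_map f T \<subseteq> complete_graph n"
proof
  fix e' assume "e' \<in> graph_map f T"
  then obtain e where e: "e \<in> T" "e' = f ` e" by (auto simp: graph_map_def)
  have "e \<subseteq> verts T" using e edge_subset_verts by blast
  then have "inj_on f e" "f ` e \<subseteq> {1..n}"
    using assms(2) by (auto simp: embeddings_def intro: inj_on_subset)
  moreover have "card e = 2" using e assms(1) by (auto simp: complete_graph_def)
  ultimately show "e' \<in> complete_graph n"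
    using e by (simp add: complete_graph_def card_image)
qed

lemma restrict_embeddings:
  assumes "S \<subseteq> T" "f \<in> embeddings n T"
  shows "restrict f (verts S) \<in> embeddings n S"
proof -
  have "verts S \<subseteq> verts T" by (rule verts_mono[OF assms(1)])
  then show ?thesis using assms(2)
    by (auto simp: embeddings_def intro: inj_on_subset)
qed

text \<open>Only the values on \<open>verts T\<close> matter, and they lie in \<open>{1..n}\<close>
  because each such vertex is on an edge. Restriction thus gives an extensional embedding with the
  same image. Several embeddings may yield the same copy.\<close>

lemma copies_eq:
  assumes "T \<subseteq> complete_graph m"
  shows "copies n T = (\<lambda>f. graph_map f T) ` embeddings n T"
proof (intro equalityI subsetI)
  fix h assume "h \<in> copies n T"
  then obtain f where f: "h \<subseteq> complete_graph n" "inj_on f (verts T)" "h = graph_map f T"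
    by (auto simp: copies_def graph_map_def)
  have "f ` verts T \<subseteq> {1..n}"
    using verts_complete_graph[OF f(1)] f(3) by (simp add: verts_graph_map)
  then have "restrict f (verts T) \<in> embeddings n T"
    using f(2) by (auto simp: embeddings_def)
  moreover have "h = graph_map (restrict f (verts T)) T"
    unfolding f(3) by (rule graph_map_cong) simp
  ultimately show "h \<in> (\<lambda>f. graph_map f T) ` embeddings n T" by blast
next
  fix h assume "h \<in> (\<lambda>f. graph_map f T) ` embeddings n T"
  then show "h \<in> copies n T"
    using graph_map_subset[OF assms] by (auto simp: copies_def graph_map_def embeddings_def)
qed

lemma finite_copies [simp]: "finite (copies n T)"
  by (rule finite_subset[of _ "Pow (complete_graph n)"]) (auto simp: copies_def)

lemma copies_subset: "h \<in> copies n T \<Longrightarrow> h \<subseteq> complete_graph n"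
  by (auto simp: copies_def)

lemma self_in_copies: "T \<subseteq> complete_graph n \<Longrightarrow> T \<in> copies n T"
  unfolding copies_def by (auto intro!: exI[of _ id])

lemma card_copy: "h \<in> copies n T \<Longrightarrow> card h = card T"
  using card_graph_map by (auto simp: copies_def graph_map_def)

lemma card_verts_copy: "h \<in> copies n T \<Longrightarrow> card (verts h) = card (verts T)"
proof -
  assume "h \<in> copies n T"
  then obtain f where "inj_on f (verts T)" "h = graph_map f T"
    by (auto simp: copies_def graph_map_def)
  then show ?thesis by (simp add: verts_graph_map card_image)
qed

section \<open>Expectations over G(n,p) as finite weighted sums\<close>

definition er_weight :: "nat \<Rightarrow> real \<Rightarrow> graph \<Rightarrow> real" where
  "er_weight n p G = p ^ card G * (1 - p) ^ card (complete_graph n - G)"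

definition er_mean :: "nat \<Rightarrow> real \<Rightarrow> (graph \<Rightarrow> real) \<Rightarrow> real" where
  "er_mean n p f = (\<Sum>G\<in>Pow (complete_graph n). er_weight n p G * f G)"

lemma er_weight_nonneg: "0 < p \<Longrightarrow> p < 1 \<Longrightarrow> 0 \<le> er_weight n p G"
  by (simp add: er_weight_def)

text \<open>This is the probability of containing \<open>A\<close> and avoiding \<open>B\<close>.
  Letting \<open>f\<close> vanish on \<open>B\<close> and \<open>g\<close> on \<open>A\<close> kills
  exactly the unwanted graphs in the expansion of the product of \<open>f e + g e\<close> over all
  edges, and that product is then evaluated edge by edge.\<close>

lemma sum_er_weight:
  assumes "A \<subseteq> complete_graph n" "B \<subseteq> complete_graph n" "A \<inter> B = {}"
  shows "(\<Sum>G\<in>{G \<in> Pow (complete_graph n). A \<subseteq> G \<and> G \<inter> B = {}}. er_weight n p G) =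
    p ^ card A * (1 - p) ^ card B"
proof -
  define E where "E = complete_graph n"
  define f g where "f = (\<lambda>e. if e \<in> B then 0 else p)" and "g = (\<lambda>e. if e \<in> A then 0 else 1 - p)"
  have fin: "finite E" by (simp add: E_def)
  have fG: "finite G" if "G \<subseteq> E" for G using that fin by (rule finite_subset)
  have "prod f G * prod g (E - G) = (if A \<subseteq> G \<and> G \<inter> B = {} then er_weight n p G else 0)"
    if "G \<in> Pow E" for G
  proof (cases "A \<subseteq> G \<and> G \<inter> B = {}")
    case True
    have "prod f G = (\<Prod>e\<in>G. p)"
      using True by (intro prod.cong) (auto simp: f_def)
    moreover have "prod g (E - G) = (\<Prod>e\<in>E - G. 1 - p)"
      using True by (intro prod.cong) (auto simp: g_def)
    ultimately show ?thesis using True by (simp add: er_weight_def E_def)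
  next
    case False
    then have "(\<exists>e\<in>G. f e = 0) \<or> (\<exists>e\<in>E - G. g e = 0)"
      using assms that by (auto simp: f_def g_def E_def)
    then have "prod f G = 0 \<or> prod g (E - G) = 0"
      using fG[of G] fG[of "E - G"] that by (auto simp: prod_zero_iff)
    then show ?thesis using False by auto
  qed
  then have "(\<Sum>G\<in>Pow E. prod f G * prod g (E - G)) =
      (\<Sum>G\<in>Pow E. if A \<subseteq> G \<and> G \<inter> B = {} then er_weight n p G else 0)"
    by (rule sum.cong[OF refl])
  also have "\<dots> = (\<Sum>G\<in>{G \<in> Pow E. A \<subseteq> G \<and> G \<inter> B = {}}. er_weight n p G)"
    using fin by (intro sum.inter_filter[symmetric]) auto
  finally have "(\<Sum>G\<in>{G \<in> Pow E. A \<subseteq> G \<and> G \<inter> B = {}}. er_weight n p G) = (\<Prod>e\<in>E. f e + g e)"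
    using prod_add[OF fin, of f g] by simp
  also have "\<dots> = (\<Prod>e\<in>E. (if e \<in> A then p else 1) * (if e \<in> B then 1 - p else 1))"
    using assms(3) by (intro prod.cong) (auto simp: f_def g_def)
  also have "\<dots> = (\<Prod>e\<in>E. if e \<in> A then p else 1) * (\<Prod>e\<in>E. if e \<in> B then 1 - p else 1)"
    by (rule prod.distrib)
  also have "\<dots> = p ^ card A * (1 - p) ^ card B"
    using assms fin by (simp add: prod.inter_restrict[symmetric] Int_absorb1 E_def)
  finally show ?thesis by (simp add: E_def)
qed

lemma er_mean_supset:
  assumes "A \<subseteq> complete_graph n"
  shows "er_mean n p (\<lambda>G. if A \<subseteq> G then 1 else 0) = p ^ card A"
proof -
  have "er_mean n p (\<lambda>G. if A \<subseteq> G then 1 else 0) =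
      (\<Sum>G\<in>Pow (complete_graph n). if A \<subseteq> G then er_weight n p G else 0)"
    unfolding er_mean_def by (intro sum.cong) auto
  also have "\<dots> = (\<Sum>G\<in>{G \<in> Pow (complete_graph n). A \<subseteq> G}. er_weight n p G)"
    by (intro sum.inter_filter[symmetric]) auto
  finally show ?thesis using sum_er_weight[OF assms, of "{}" p] by simp
qed

lemma er_mean_const: "er_mean n p (\<lambda>_. c) = c"
proof -
  have "er_mean n p (\<lambda>_. c) = c * er_mean n p (\<lambda>G. if {} \<subseteq> G then 1 else 0)"
    by (simp add: er_mean_def sum_distrib_left mult.commute)
  then show ?thesis by (subst (asm) er_mean_supset) auto
qed

lemma er_mean_mono:
  assumes "0 < p" "p < 1" "\<And>G. G \<subseteq> complete_graph n \<Longrightarrow> f G \<le> g G"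
  shows "er_mean n p f \<le> er_mean n p g"
  unfolding er_mean_def using assms er_weight_nonneg by (intro sum_mono mult_left_mono) auto

lemma er_mean_add: "er_mean n p (\<lambda>G. f G + g G) = er_mean n p f + er_mean n p g"
  by (simp add: er_mean_def distrib_left sum.distrib)

lemma er_mean_diff: "er_mean n p (\<lambda>G. f G - g G) = er_mean n p f - er_mean n p g"
  by (simp add: er_mean_def right_diff_distrib sum_subtractf)

lemma er_mean_cmult: "er_mean n p (\<lambda>G. c * f G) = c * er_mean n p f"
  by (simp add: er_mean_def sum_distrib_left mult.left_commute)

lemma er_mean_sum: "er_mean n p (\<lambda>G. \<Sum>i\<in>I. f i G) = (\<Sum>i\<in>I. er_mean n p (f i))"
  unfolding er_mean_def by (simp only: sum_distrib_left) (rule sum.swap)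

text \<open>Change of measure: with respect to G(n,p), the graph with \<open>h\<close> planted has
  density \<open>1 / p ^ card h\<close> on the graphs containing \<open>h\<close>, and 0
  elsewhere.\<close>

lemma er_mean_planted:
  assumes "h \<subseteq> complete_graph n" "0 < p"
  shows "er_mean n p (\<lambda>G. f (h \<union> G)) =
    (\<Sum>G\<in>Pow (complete_graph n). if h \<subseteq> G then er_weight n p G * f G else 0) / p ^ card h"
proof -
  define E where "E = complete_graph n"
  have fin: "finite E" "finite h" using assms by (auto simp: E_def intro: finite_subset)
  have "(\<Sum>G0\<in>{G0 \<in> Pow E. h \<union> G0 = G}. er_weight n p G0) = er_weight n p G / p ^ card h"
    if "G \<in> Pow E" "h \<subseteq> G" for G
  proof -
    \<comment> \<open>The union determines the noise outside \<open>h\<close> and leaves its edges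
      inside \<open>h\<close> free.\<close>
    have "{G0 \<in> Pow E. h \<union> G0 = G} = {G0 \<in> Pow E. G - h \<subseteq> G0 \<and> G0 \<inter> (E - G) = {}}"
      using that by auto
    then have "(\<Sum>G0\<in>{G0 \<in> Pow E. h \<union> G0 = G}. er_weight n p G0) =
        p ^ card (G - h) * (1 - p) ^ card (E - G)"
      using sum_er_weight[of "G - h" n "E - G" p] that by (auto simp: E_def)
    moreover have "p ^ card G = p ^ card (G - h) * p ^ card h"
      using that fin card_Diff_subset[of h G] card_mono[of G h] finite_subset[of G E]
      by (auto simp: power_add[symmetric])
    ultimately show ?thesis using assms(2) by (simp add: er_weight_def E_def)
  qed
  note inner = this
  have "er_mean n p (\<lambda>G. f (h \<union> G)) = (\<Sum>G0\<in>Pow E. er_weight n p G0 * f (h \<union> G0))"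
    by (simp add: er_mean_def E_def)
  also have "\<dots> = (\<Sum>G\<in>{G \<in> Pow E. h \<subseteq> G}. \<Sum>G0\<in>{G0 \<in> Pow E. h \<union> G0 = G}.
      er_weight n p G0 * f (h \<union> G0))"
    using fin assms(1) by (intro sum.group[symmetric]) (auto simp: E_def)
  also have "\<dots> = (\<Sum>G\<in>{G \<in> Pow E. h \<subseteq> G}. er_weight n p G * f G / p ^ card h)"
  proof (rule sum.cong[OF refl])
    fix G assume G: "G \<in> {G \<in> Pow E. h \<subseteq> G}"
    have "(\<Sum>G0\<in>{G0 \<in> Pow E. h \<union> G0 = G}. er_weight n p G0 * f (h \<union> G0)) =
        (\<Sum>G0\<in>{G0 \<in> Pow E. h \<union> G0 = G}. er_weight n p G0) * f G"
      unfolding sum_distrib_right by (intro sum.cong) auto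
    then show "(\<Sum>G0\<in>{G0 \<in> Pow E. h \<union> G0 = G}. er_weight n p G0 * f (h \<union> G0)) =
        er_weight n p G * f G / p ^ card h"
      using inner[of G] G by simp
  qed
  also have "\<dots> = (\<Sum>G\<in>Pow E. if h \<subseteq> G then er_weight n p G * f G / p ^ card h else 0)"
    using fin by (intro sum.inter_filter) auto
  also have "\<dots> = (\<Sum>G\<in>Pow E. if h \<subseteq> G then er_weight n p G * f G else 0) / p ^ card h"
    unfolding sum_divide_distrib by (intro sum.cong) auto
  finally show ?thesis by (simp add: E_def)
qed

text \<open>The second argument of \<open>f\<close> receives the observed graph, not the
  noise.\<close>

definition planted_mean :: "nat \<Rightarrow> graph \<Rightarrow> real \<Rightarrow> (graph \<Rightarrow> graph \<Rightarrow> real) \<Rightarrow> real" where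
  "planted_mean n H p f =
     (\<Sum>h\<in>copies n H. er_mean n p (\<lambda>G. f h (h \<union> G))) / real (card (copies n H))"

lemma pmf_erdos_renyi:
  assumes "0 < p" "p < 1" "G \<subseteq> complete_graph n"
  shows "pmf (erdos_renyi n p) G = er_weight n p G"
proof -
  define E where "E = complete_graph n"
  have fin: "finite E" by (simp add: E_def)
  let ?P = "Pi_pmf E False (\<lambda>_. bernoulli_pmf p)"
  have "pmf (erdos_renyi n p) G = measure ?P ((\<lambda>b. {e \<in> E. b e}) -` {G})"
    by (simp add: erdos_renyi_def pmf_map E_def)
  also have "\<dots> = measure ?P {\<lambda>e. e \<in> G}"
  \<comment> \<open>The preimage also contains functions that are true at non-edges; these lie
    outside the support of \<open>Pi_pmf\<close>, whose default value is
    \<open>False\<close>.\<close>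
  proof (rule measure_pmf.finite_measure_eq_AE)
    show "AE b in ?P. (b \<in> (\<lambda>b. {e \<in> E. b e}) -` {G}) = (b \<in> {\<lambda>e. e \<in> G})"
      using set_Pi_pmf_subset[OF fin, of False "\<lambda>_. bernoulli_pmf p"] assms(3)
      by (fastforce simp: AE_measure_pmf_iff E_def)
  qed auto
  also have "\<dots> = pmf ?P (\<lambda>e. e \<in> G)"
    by (simp add: measure_pmf_single)
  also have "\<dots> = (\<Prod>e\<in>E. pmf (bernoulli_pmf p) (e \<in> G))"
    using assms(3) fin by (intro pmf_Pi') (auto simp: E_def)
  also have "\<dots> = (\<Prod>e\<in>E. if e \<in> G then p else 1 - p)"
    using assms by (intro prod.cong) auto
  also have "\<dots> = (\<Prod>e\<in>G. p) * (\<Prod>e\<in>E - G. 1 - p)"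
    using assms(3) fin by (subst prod.If_cases) (auto simp: Int_absorb1 Diff_eq E_def)
  finally show ?thesis by (simp add: er_weight_def E_def)
qed

lemma set_erdos_renyi: "set_pmf (erdos_renyi n p) \<subseteq> Pow (complete_graph n)"
  by (auto simp: erdos_renyi_def)

lemma copies_nonempty: "H \<subseteq> complete_graph n \<Longrightarrow> copies n H \<noteq> {}"
  using self_in_copies by blast

lemma set_planted_model:
  assumes "H \<subseteq> complete_graph n"
  shows "set_pmf (planted_model n H p) \<subseteq> copies n H \<times> Pow (complete_graph n)"
  using set_erdos_renyi copies_nonempty[OF assms] by (auto simp: planted_model_def)

lemma expectation_planted_model:
  assumes "H \<subseteq> complete_graph n" "0 < p" "p < 1"
  shows "measure_pmf.expectation (planted_model n H p) (\<lambda>\<omega>. f (fst \<omega>) (observed \<omega>)) =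
    planted_mean n H p f"
proof -
  let ?C = "copies n H" and ?E = "complete_graph n"
  have "measure_pmf.expectation (planted_model n H p) (\<lambda>\<omega>. f (fst \<omega>) (observed \<omega>)) =
      (\<Sum>\<omega>\<in>?C \<times> Pow ?E. f (fst \<omega>) (observed \<omega>) * pmf (planted_model n H p) \<omega>)"
    using set_planted_model[OF assms(1)] by (intro integral_measure_pmf_real) auto
  also have "\<dots> = (\<Sum>\<omega>\<in>?C \<times> Pow ?E.
      er_weight n p (snd \<omega>) * f (fst \<omega>) (fst \<omega> \<union> snd \<omega>) / real (card ?C))"
    using assms by (intro sum.cong) (auto simp: planted_model_def pmf_pair pmf_erdos_renyi
      observed_def pmf_of_set[OF copies_nonempty[OF assms(1)] finite_copies])
  also have "\<dots> = (\<Sum>h\<in>?C. \<Sum>G\<in>Pow ?E. er_weight n p G * f h (h \<union> G) / real (card ?C))"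
    by (subst sum.Sigma) (auto simp: case_prod_unfold)
  finally show ?thesis
    by (simp add: planted_mean_def er_mean_def sum_divide_distrib)
qed

text \<open>Bayes' formula: regrouped by the observed graph \<open>G\<close>, all copies inside
  \<open>G\<close> carry the same weight, since they have equally many edges.\<close>

lemma planted_mean_observed:
  assumes "H \<subseteq> complete_graph n" "0 < p"
  shows "planted_mean n H p f =
    (\<Sum>G\<in>Pow (complete_graph n). er_weight n p G * (\<Sum>h\<in>{h \<in> copies n H. h \<subseteq> G}. f h G)) /
    (real (card (copies n H)) * p ^ card H)"
proof -
  let ?C = "copies n H" and ?E = "complete_graph n"
  have "(\<Sum>h\<in>?C. er_mean n p (\<lambda>G. f h (h \<union> G))) =
      (\<Sum>h\<in>?C. (\<Sum>G\<in>Pow ?E. if h \<subseteq> G then er_weight n p G * f h G else 0) / p ^ card H)"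
    using er_mean_planted[OF copies_subset assms(2)] by (intro sum.cong) (auto simp: card_copy)
  also have "\<dots> = (\<Sum>h\<in>?C. \<Sum>G\<in>Pow ?E. if h \<subseteq> G then er_weight n p G * f h G else 0) / p ^ card H"
    by (simp add: sum_divide_distrib)
  also have "(\<Sum>h\<in>?C. \<Sum>G\<in>Pow ?E. if h \<subseteq> G then er_weight n p G * f h G else 0) =
      (\<Sum>G\<in>Pow ?E. \<Sum>h\<in>?C. if h \<subseteq> G then er_weight n p G * f h G else 0)"
    by (rule sum.swap)
  also have "\<dots> = (\<Sum>G\<in>Pow ?E. er_weight n p G * (\<Sum>h\<in>{h \<in> ?C. h \<subseteq> G}. f h G))"
    by (simp add: sum.inter_filter sum_distrib_left) (intro sum.cong refl, auto)
  finally show ?thesis by (simp add: planted_mean_def)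
qed

subsection \<open>The posterior law and the overlap\<close>

text \<open>The posterior law of the planted copy given the observed graph is uniform on the copies it
  contains, because \<open>card (G - h)\<close> is the same for all of them.\<close>

definition posterior_edge :: "nat \<Rightarrow> graph \<Rightarrow> nat set \<Rightarrow> graph \<Rightarrow> real" where
  "posterior_edge n H e G =
     real (card {h \<in> copies n H. h \<subseteq> G \<and> e \<in> h}) / real (card {h \<in> copies n H. h \<subseteq> G})"

lemma finite_set_planted_model:
  assumes "H \<subseteq> complete_graph n"
  shows "finite (set_pmf (planted_model n H p))"
  by (rule finite_subset[OF set_planted_model[OF assms]]) simp

text \<open>The multiplied form also covers graphs without any copy of \<open>H\<close>, where the
  posterior is \<open>0 / 0 = 0\<close>.\<close>

lemma sum_posterior_edge:
  "(\<Sum>h\<in>{h \<in> copies n H. h \<subseteq> G}. indicator h e) =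
     real (card {h \<in> copies n H. h \<subseteq> G}) * posterior_edge n H e G"
proof (cases "{h \<in> copies n H. h \<subseteq> G} = {}")
  case True
  then show ?thesis by (simp only: sum.empty card.empty of_nat_0 mult_zero_left)
next
  case False
  have "(\<Sum>h\<in>{h \<in> copies n H. h \<subseteq> G}. indicator h e) =
      (\<Sum>h\<in>{h \<in> copies n H. h \<subseteq> G}. if e \<in> h then 1 else (0::real))"
    by (intro sum.cong) (auto simp: indicator_def)
  also have "\<dots> = (\<Sum>h\<in>{h \<in> {h \<in> copies n H. h \<subseteq> G}. e \<in> h}. 1)"
    by (intro sum.inter_filter[symmetric]) auto
  also have "\<dots> = real (card {h \<in> copies n H. h \<subseteq> G \<and> e \<in> h})"
    by (simp add: conj_assoc)
  finally show ?thesis using False by (simp add: posterior_edge_def)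
qed

lemma subalgebra_observed: "subalgebra (measure_pmf M) observed_algebra"
  by (auto simp: subalgebra_def observed_algebra_def)

text \<open>Conditional expectation is characterised by its integrals over observable events. Such
  an event is a preimage under \<open>observed\<close>, so after regrouping by \<open>G\<close> its
  indicator factors out of the sum over the copies in \<open>G\<close>, and that sum is the
  posterior times their number.\<close>

lemma cond_exp_planted_edge:
  assumes "H \<subseteq> complete_graph n" "0 < p" "p < 1"
  shows "AE \<omega> in measure_pmf (planted_model n H p).
    real_cond_exp (measure_pmf (planted_model n H p)) observed_algebra (planted_edge e) \<omega> =
    posterior_edge n H e (observed \<omega>)"
proof -
  let ?M = "planted_model n H p"
  interpret sigma_finite_subalgebra "measure_pmf ?M" observed_algebra
    by (intro finite_measure_subalgebra_is_sigma_finite finite_measure_subalgebra.intro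
      finite_measure_subalgebra_axioms.intro measure_pmf.finite_measure_axioms
      subalgebra_observed)
  have int: "integrable (measure_pmf ?M) f" for f :: "graph \<times> graph \<Rightarrow> real"
    by (rule integrable_measure_pmf_finite[OF finite_set_planted_model[OF assms(1)]])
  show ?thesis
  proof (rule real_cond_exp_charact)
    fix A assume "A \<in> sets observed_algebra"
    then obtain B where A: "A = observed -` B"
      by (auto simp: observed_algebra_def sets_vimage_algebra2)
    have "set_lebesgue_integral (measure_pmf ?M) A (planted_edge e) =
        planted_mean n H p (\<lambda>h G. indicator B G * indicator h e)"
      unfolding expectation_planted_model[OF assms, symmetric] set_lebesgue_integral_def
      by (intro arg_cong2[where f=lebesgue_integral] refl ext)
        (auto simp: A planted_edge_def indicator_def)
    also have "\<dots> = planted_mean n H p (\<lambda>h G. indicator B G * posterior_edge n H e G)"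
      unfolding planted_mean_observed[OF assms(1,2)]
      by (simp only: sum_distrib_left[symmetric] sum_posterior_edge sum_constant)
    also have "\<dots> =
        set_lebesgue_integral (measure_pmf ?M) A (\<lambda>\<omega>. posterior_edge n H e (observed \<omega>))"
      unfolding expectation_planted_model[OF assms, symmetric] set_lebesgue_integral_def
      by (intro arg_cong2[where f=lebesgue_integral] refl ext) (auto simp: A indicator_def)
    finally show "set_lebesgue_integral (measure_pmf ?M) A (planted_edge e) = \<dots>" .
  next
    have "observed \<in> measurable observed_algebra (count_space UNIV)"
      unfolding observed_algebra_def by (rule measurable_vimage_algebra1) simp
    then show "(\<lambda>\<omega>. posterior_edge n H e (observed \<omega>)) \<in> borel_measurable observed_algebra"
      by (rule measurable_compose) simp
  qed (rule int)+
qed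

text \<open>The mean number of edges that \<open>h\<close> shares with an independent second sample
  from the posterior given \<open>G\<close>; it is 0 if \<open>G\<close> contains no copy.\<close>

definition overlap :: "nat \<Rightarrow> graph \<Rightarrow> graph \<Rightarrow> graph \<Rightarrow> real" where
  "overlap n H h G = (\<Sum>h'\<in>{h \<in> copies n H. h \<subseteq> G}. real (card (h \<inter> h'))) /
     real (card {h \<in> copies n H. h \<subseteq> G})"

lemma sum_indicator_card:
  assumes "A \<subseteq> B" "finite B"
  shows "(\<Sum>x\<in>B. indicator A x) = real (card A)"
  using assms by (simp add: indicator_def sum.If_cases Int_absorb1 Collect_mem_eq)

lemma overlap_eq_sum:
  assumes "h \<in> copies n H"
  shows "overlap n H h G = (\<Sum>e\<in>complete_graph n. indicator h e * posterior_edge n H e G)"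
proof -
  let ?C = "{h \<in> copies n H. h \<subseteq> G}" and ?E = "complete_graph n"
  have "(\<Sum>h'\<in>?C. real (card (h \<inter> h'))) = (\<Sum>h'\<in>?C. \<Sum>e\<in>?E. indicator h e * indicator h' e)"
  proof (rule sum.cong[OF refl])
    fix h'
    show "real (card (h \<inter> h')) = (\<Sum>e\<in>?E. indicator h e * indicator h' e)"
      using copies_subset[OF assms]
      by (subst sum_indicator_card[of _ ?E, symmetric]) (auto simp: indicator_inter_arith)
  qed
  also have "\<dots> = (\<Sum>e\<in>?E. \<Sum>h'\<in>?C. indicator h e * indicator h' e)"
    by (rule sum.swap)
  also have "\<dots> = (\<Sum>e\<in>?E. indicator h e * (real (card ?C) * posterior_edge n H e G))"
    by (simp only: sum_distrib_left[symmetric] sum_posterior_edge)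
  also have "\<dots> = real (card ?C) * (\<Sum>e\<in>?E. indicator h e * posterior_edge n H e G)"
    by (simp only: sum_distrib_left mult.left_commute)
  finally have eq: "(\<Sum>h'\<in>?C. real (card (h \<inter> h'))) = \<dots>" .
  show ?thesis
  proof (cases "?C = {}")
    case True
    then have "posterior_edge n H e G = 0" for e
      unfolding posterior_edge_def by (simp only: True card.empty of_nat_0 div_by_0)
    then show ?thesis by (simp only: overlap_def True) simp
  next
    case False
    then have "card ?C \<noteq> 0" by simp
    then show ?thesis unfolding overlap_def eq by simp
  qed
qed

section \<open>Calculus of planted averages and the overlap formula for the MMSE\<close>

lemma planted_mean_const:
  assumes "H \<subseteq> complete_graph n"
  shows "planted_mean n H p (\<lambda>_ _. c) = c"
  using copies_nonempty[OF assms] by (simp add: planted_mean_def er_mean_const)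

lemma planted_mean_diff:
  "planted_mean n H p (\<lambda>h G. f h G - g h G) = planted_mean n H p f - planted_mean n H p g"
  by (simp add: planted_mean_def er_mean_diff sum_subtractf diff_divide_distrib)

lemma planted_mean_add:
  "planted_mean n H p (\<lambda>h G. f h G + g h G) = planted_mean n H p f + planted_mean n H p g"
  by (simp add: planted_mean_def er_mean_add sum.distrib add_divide_distrib)

lemma planted_mean_cmult:
  "planted_mean n H p (\<lambda>h G. c * f h G) = c * planted_mean n H p f"
  by (simp add: planted_mean_def er_mean_cmult sum_distrib_left[symmetric])

lemma planted_mean_mono:
  assumes "0 < p" "p < 1"
    and "\<And>h G. h \<in> copies n H \<Longrightarrow> h \<subseteq> G \<Longrightarrow> G \<subseteq> complete_graph n \<Longrightarrow> f h G \<le> g h G"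
  shows "planted_mean n H p f \<le> planted_mean n H p g"
  unfolding planted_mean_def
  by (intro divide_right_mono sum_mono er_mean_mono assms) (auto dest: copies_subset)

lemma planted_mean_le:
  assumes "H \<subseteq> complete_graph n"
    and "\<And>h. h \<in> copies n H \<Longrightarrow> er_mean n p (\<lambda>G. f h (h \<union> G)) \<le> c"
  shows "planted_mean n H p f \<le> c"
proof -
  have "(\<Sum>h\<in>copies n H. er_mean n p (\<lambda>G. f h (h \<union> G))) \<le> real (card (copies n H)) * c"
    using assms(2) by (intro sum_bounded_above) auto
  moreover have "card (copies n H) > 0"
    using copies_nonempty[OF assms(1)] by (simp add: card_gt_0_iff)
  ultimately show ?thesis
    unfolding planted_mean_def by (simp add: divide_le_eq mult.commute)
qed

text \<open>The posterior mean is an orthogonal projection: given \<open>G\<close>, its square and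
  its product with the true indicator have the same average. Hence the squared error reduces to the
  edge count minus the overlap.\<close>

lemma MMSE_eq:
  assumes "H \<subseteq> complete_graph n" "H \<noteq> {}" "0 < p" "p < 1"
  shows "MMSE n H p = 1 - planted_mean n H p (overlap n H) / real (card H)"
proof -
  let ?M = "planted_model n H p" and ?E = "complete_graph n"
  let ?q = "posterior_edge n H"
  have "measure_pmf.expectation ?M (\<lambda>\<omega>. \<Sum>e\<in>?E. (planted_edge e \<omega> -
      real_cond_exp (measure_pmf ?M) observed_algebra (planted_edge e) \<omega>)\<^sup>2) =
    measure_pmf.expectation ?M (\<lambda>\<omega>. \<Sum>e\<in>?E. (indicator (fst \<omega>) e - ?q e (observed \<omega>))\<^sup>2)"
  proof (rule integral_cong_AE)
    have "AE \<omega> in measure_pmf ?M. \<forall>e\<in>?E.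
        real_cond_exp (measure_pmf ?M) observed_algebra (planted_edge e) \<omega> = ?q e (observed \<omega>)"
      using cond_exp_planted_edge[OF assms(1,3,4)] by (intro AE_finite_allI) auto
    then show "AE \<omega> in measure_pmf ?M. (\<Sum>e\<in>?E. (planted_edge e \<omega> -
        real_cond_exp (measure_pmf ?M) observed_algebra (planted_edge e) \<omega>)\<^sup>2) =
        (\<Sum>e\<in>?E. (indicator (fst \<omega>) e - ?q e (observed \<omega>))\<^sup>2)"
      by eventually_elim (auto simp: planted_edge_def intro!: sum.cong)
  qed auto
  also have "\<dots> = planted_mean n H p (\<lambda>h G. \<Sum>e\<in>?E. (indicator h e - ?q e G)\<^sup>2)"
    by (rule expectation_planted_model[OF assms(1,3,4)])
  also have "\<dots> = planted_mean n H p
      (\<lambda>h G. \<Sum>e\<in>?E. indicator h e - indicator h e * ?q e G)"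
  proof -
    have "(\<Sum>h\<in>{h \<in> copies n H. h \<subseteq> G}. \<Sum>e\<in>?E. (indicator h e - ?q e G)\<^sup>2) =
        (\<Sum>h\<in>{h \<in> copies n H. h \<subseteq> G}. \<Sum>e\<in>?E. indicator h e - indicator h e * ?q e G)" for G
    proof -
      let ?C = "{h \<in> copies n H. h \<subseteq> G}"
      have "(\<Sum>h\<in>?C. (indicator h e - ?q e G)\<^sup>2) =
          (\<Sum>h\<in>?C. indicator h e - indicator h e * ?q e G)" for e
      proof -
        \<comment> \<open>Since an indicator equals its square, the error splits into the wanted
          term and a term whose sum over the copies in \<open>G\<close> is 0.\<close>
        have "(indicator h e - ?q e G)\<^sup>2 =
            (indicator h e - indicator h e * ?q e G) +
            (?q e G * ?q e G - ?q e G * indicator h e)" for h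
          by (simp add: indicator_def power2_eq_square algebra_simps)
        then have "(\<Sum>h\<in>?C. (indicator h e - ?q e G)\<^sup>2) =
            (\<Sum>h\<in>?C. indicator h e - indicator h e * ?q e G) +
            (\<Sum>h\<in>?C. ?q e G * ?q e G - ?q e G * indicator h e)"
          by (simp only: sum.distrib)
        moreover have "(\<Sum>h\<in>?C. ?q e G * ?q e G - ?q e G * indicator h e) = 0"
          by (simp only: sum_subtractf sum_distrib_left[symmetric] sum_posterior_edge) simp
        ultimately show ?thesis by simp
      qed
      then show ?thesis
        by (subst (1 2) sum.swap) (rule sum.cong[OF refl])
    qed
    then show ?thesis
      by (simp only: planted_mean_observed[OF assms(1,3)])
  qed
  also have "\<dots> = planted_mean n H p (\<lambda>h G. real (card H) - overlap n H h G)"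
  proof -
    have "(\<Sum>e\<in>?E. indicator h e - indicator h e * ?q e G) = real (card H) - overlap n H h G"
      if "h \<in> copies n H" for h G
      using sum_indicator_card[OF copies_subset[OF that]] card_copy[OF that]
      by (simp add: sum_subtractf overlap_eq_sum[OF that])
    then show ?thesis
      unfolding planted_mean_def by simp
  qed
  also have "\<dots> = real (card H) - planted_mean n H p (overlap n H)"
    using planted_mean_diff[of n H p "\<lambda>_ _. real (card H)" "overlap n H"]
    by (simp add: planted_mean_const[OF assms(1)])
  finally have "MMSE n H p = 1 / real (card H) * (real (card H) - planted_mean n H p (overlap n H))"
    by (simp add: MMSE_def)
  moreover have "card H \<noteq> 0"
    using assms by (auto dest: finite_subset)
  ultimately show ?thesis by (simp add: field_simps)
qed

lemma divide_le_of_le_mult: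
  fixes a b c :: real
  assumes "a \<le> b * c" "0 \<le> b" "0 \<le> c"
  shows "a / b \<le> c"
  using assms by (cases "b = 0") (auto simp: divide_le_eq mult.commute)

lemma overlap_nonneg: "0 \<le> overlap n H h G"
  by (simp add: overlap_def sum_nonneg)

lemma overlap_le_card:
  assumes "h \<in> copies n H"
  shows "overlap n H h G \<le> real (card H)"
proof -
  let ?C = "{h \<in> copies n H. h \<subseteq> G}"
  have "finite h" using copies_subset[OF assms] by (rule finite_subset) simp
  then have "(\<Sum>h'\<in>?C. real (card (h \<inter> h'))) \<le> real (card ?C) * real (card H)"
    using card_copy[OF assms] by (intro sum_bounded_above) (metis card_mono inf_le1 of_nat_mono)
  then show ?thesis
    unfolding overlap_def by (rule divide_le_of_le_mult) auto
qed

subsection \<open>Lower bound on the overlap\<close>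

text \<open>After dropping injectivity the sum factorises over vertices. A vertex sent into
  \<open>W\<close> has \<open>card W\<close> choices, and all choices outside \<open>W\<close>,
  weighted by \<open>1 / n\<close>, contribute at most 1.\<close>

lemma sum_power_outside_le:
  assumes "finite V" "W \<subseteq> {1..n}"
  shows "(\<Sum>f\<in>V \<rightarrow>\<^sub>E {1..n}. (1 / real n) ^ card {v \<in> V. f v \<notin> W}) \<le> (real (card W) + 1) ^ card V"
proof -
  let ?g = "\<lambda>x. if x \<in> W then 1 else 1 / real n"
  have "(1 / real n) ^ card {v \<in> V. f v \<notin> W} = (\<Prod>v\<in>V. ?g (f v))" for f
  proof -
    have "(\<Prod>v\<in>V. ?g (f v)) = (\<Prod>v\<in>V. if f v \<notin> W then 1 / real n else 1)"
      by (intro prod.cong) auto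
    also have "\<dots> = (\<Prod>v\<in>{v \<in> V. f v \<notin> W}. 1 / real n)"
      by (rule prod.inter_filter[OF assms(1), symmetric])
    finally show ?thesis by simp
  qed
  then have "(\<Sum>f\<in>V \<rightarrow>\<^sub>E {1..n}. (1 / real n) ^ card {v \<in> V. f v \<notin> W}) =
      (\<Sum>f\<in>V \<rightarrow>\<^sub>E {1..n}. \<Prod>v\<in>V. ?g (f v))"
    by simp
  also have "\<dots> = (\<Prod>v\<in>V. \<Sum>x\<in>{1..n}. ?g x)"
    by (rule prod_sum_PiE[symmetric]) (use assms in auto)
  also have "\<dots> = (\<Sum>x\<in>{1..n}. ?g x) ^ card V"
    by simp
  also have "\<dots> \<le> (real (card W) + 1) ^ card V"
  proof (rule power_mono)
    have "(\<Sum>x\<in>{1..n}. ?g x) \<le> (\<Sum>x\<in>{1..n}. (if x \<in> W then 1 else 0) + 1 / real n)"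
      by (intro sum_mono) auto
    also have "\<dots> = (\<Sum>x\<in>{1..n}. if x \<in> W then 1 else 0) + real n * (1 / real n)"
      by (simp add: sum.distrib)
    also have "(\<Sum>x\<in>{1..n}. if x \<in> W then 1 else (0::real)) = real (card W)"
      using assms(2) by (simp add: sum.If_cases Int_absorb1 Collect_mem_eq)
    finally show "(\<Sum>x\<in>{1..n}. ?g x) \<le> real (card W) + 1"
      by (cases "n = 0") auto
  qed (simp add: sum_nonneg)
  finally show ?thesis .
qed

text \<open>Pulling the overlap back to a subgraph of \<open>T\<close> makes the onion inequalities
  applicable to it.\<close>

lemma card_graph_map_Int:
  assumes "inj_on f (verts T)"
  shows "card (graph_map f T \<inter> h) = card {e \<in> T. f ` e \<in> h}"
proof -
  have "graph_map f T \<inter> h = graph_map f {e \<in> T. f ` e \<in> h}"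
    by (auto simp: graph_map_def)
  moreover have "inj_on f (verts {e \<in> T. f ` e \<in> h})"
    by (rule inj_on_subset[OF assms verts_mono]) auto
  ultimately show ?thesis by (simp add: card_graph_map)
qed

text \<open>An edge sent into \<open>h\<close> has both ends sent into \<open>verts h\<close>, so
  its vertices are disjoint from those that leave \<open>verts h\<close>.\<close>

lemma card_verts_preimage_le:
  assumes "finite (verts T)"
  shows "card (verts {e \<in> T. f ` e \<in> h}) + card {v \<in> verts T. f v \<notin> verts h} \<le> card (verts T)"
proof -
  have "verts {e \<in> T. f ` e \<in> h} \<subseteq> verts T - {v \<in> verts T. f v \<notin> verts h}"
    by (fastforce simp: verts_def)
  then have "card (verts {e \<in> T. f ` e \<in> h}) \<le> card (verts T - {v \<in> verts T. f v \<notin> verts h})"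
    using assms by (intro card_mono) auto
  also have "\<dots> = card (verts T) - card {v \<in> verts T. f v \<notin> verts h}"
    using assms by (intro card_Diff_subset) auto
  finally show ?thesis
    using card_mono[of "verts T" "{v \<in> verts T. f v \<notin> verts h}"] assms by auto
qed

text \<open>First moment with \<open>h\<close> planted: an embedding appears with probability
  \<open>p\<close> to the number of its edges outside \<open>h\<close>. The hypothesis
  \<open>le\<close> trades this for a factor \<open>1 / n\<close> per vertex outside
  \<open>h\<close>, which cancels the choices of that vertex.\<close>

lemma er_mean_count_le:
  assumes T: "T \<subseteq> complete_graph m" and h: "h \<subseteq> complete_graph n"
    and F: "F \<subseteq> embeddings n T" and c: "0 \<le> c" and p: "0 < p" "p < 1"
    and le: "\<And>f. f \<in> F \<Longrightarrow> p ^ (card T - card {e \<in> T. f ` e \<in> h}) \<le>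
        c * (1 / real n) ^ card {v \<in> verts T. f v \<notin> verts h}"
  shows "er_mean n p (\<lambda>G. real (card {f \<in> F. graph_map f T \<subseteq> h \<union> G})) \<le>
    c * (real (card (verts h)) + 1) ^ card (verts T)"
proof -
  have finV: "finite (verts T)" by (rule finite_verts[OF T])
  have finT: "finite T" using T by (rule finite_subset) simp
  have finF: "finite F" using F finV by (auto intro: finite_subset)
  have "er_mean n p (\<lambda>G. real (card {f \<in> F. graph_map f T \<subseteq> h \<union> G})) =
      er_mean n p (\<lambda>G. \<Sum>f\<in>F. if graph_map f T - h \<subseteq> G then 1 else 0)"
  proof (intro arg_cong[where f="er_mean n p"] ext)
    fix G
    \<comment> \<open>Edges already in \<open>h\<close> are present for free; only the others must
      come from the noise.\<close>
    have "{f \<in> F. graph_map f T \<subseteq> h \<union> G} = {f \<in> F. graph_map f T - h \<subseteq> G}" by auto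
    then show "real (card {f \<in> F. graph_map f T \<subseteq> h \<union> G}) =
        (\<Sum>f\<in>F. if graph_map f T - h \<subseteq> G then 1 else 0)"
      using finF by (simp add: sum.inter_filter[symmetric])
  qed
  also have "\<dots> = (\<Sum>f\<in>F. p ^ card (graph_map f T - h))"
    unfolding er_mean_sum using graph_map_subset[OF T] F
    by (intro sum.cong er_mean_supset) auto
  also have "\<dots> \<le> (\<Sum>f\<in>F. c * (1 / real n) ^ card {v \<in> verts T. f v \<notin> verts h})"
  proof (rule sum_mono)
    fix f assume f: "f \<in> F"
    then have inj: "inj_on f (verts T)" using F by (auto simp: embeddings_def)
    have "card (graph_map f T - h) = card (graph_map f T) - card (graph_map f T \<inter> h)"
      using finT by (intro card_Diff_subset_Int) (simp add: graph_map_def)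
    then have "card (graph_map f T - h) = card T - card {e \<in> T. f ` e \<in> h}"
      by (simp add: card_graph_map[OF inj] card_graph_map_Int[OF inj])
    then show "p ^ card (graph_map f T - h) \<le> c * (1 / real n) ^ card {v \<in> verts T. f v \<notin> verts h}"
      using le[OF f] by simp
  qed
  also have "\<dots> \<le> (\<Sum>f\<in>verts T \<rightarrow>\<^sub>E {1..n}. c * (1 / real n) ^ card {v \<in> verts T. f v \<notin> verts h})"
    using F finV c by (intro sum_mono2) (auto simp: embeddings_def intro!: finite_PiE)
  also have "\<dots> \<le> c * (real (card (verts h)) + 1) ^ card (verts T)"
    unfolding sum_distrib_left[symmetric]
    by (intro mult_left_mono sum_power_outside_le finV verts_complete_graph h c)
  finally show ?thesis .
qed

lemma card_inter_copy_ge: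
  assumes "J \<subseteq> H" "f \<in> embeddings n H" "finite H"
  shows "card {e \<in> J. restrict f (verts J) ` e \<in> h} \<le> card (h \<inter> graph_map f H)"
proof -
  have emb: "restrict f (verts J) \<in> embeddings n J"
    by (rule restrict_embeddings[OF assms(1,2)])
  have eq: "graph_map (restrict f (verts J)) J = graph_map f J"
    by (rule graph_map_cong) simp
  have "card {e \<in> J. restrict f (verts J) ` e \<in> h} = card (graph_map f J \<inter> h)"
    using emb by (subst card_graph_map_Int[symmetric]) (auto simp: embeddings_def eq)
  also have "\<dots> \<le> card (h \<inter> graph_map f H)"
    using graph_map_mono[OF assms(1), of f] assms(3) by (intro card_mono) (auto simp: graph_map_def)
  finally show ?thesis .
qed

text \<open>Every copy of \<open>H\<close> in \<open>G\<close> contains a copy of \<open>J\<close>.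
  If none of the copies of \<open>J\<close> in \<open>G\<close> has overlap below
  \<open>card J - x\<close> with \<open>h\<close>, the overlap is at least that large; otherwise the
  loss is charged to the number of such bad copies, whose mean is small.\<close>

lemma planted_mean_overlap_ge:
  fixes \<delta> x e p :: real
  assumes H: "H \<subseteq> complete_graph n" and J: "J \<subseteq> H" and n: "n \<ge> 1"
    and p: "0 < p" "p < 1" and \<delta>: "0 < \<delta>" "\<delta> < 1" and x: "0 \<le> x"
    and ple: "p \<le> (1 - \<delta>) * real n powr (- e)"
    and U: "\<And>S. S \<subseteq> J \<Longrightarrow>
      real (card (verts J)) - real (card (verts S)) \<le> e * (real (card J) - real (card S))"
  shows "planted_mean n H p (overlap n H) \<ge>
    real (card J) - x - real (card H) * ((1 - \<delta>) powr x * (real (card (verts H)) + 1) ^ card (verts H))"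
proof -
  define k where "k = card (verts H)"
  define B where "B h = {f \<in> embeddings n J. real (card {e \<in> J. f ` e \<in> h}) < real (card J) - x}" for h
  define N where "N h G = real (card {f \<in> B h. graph_map f J \<subseteq> G})" for h G
  have JE: "J \<subseteq> complete_graph n" using H J by auto
  have finH: "finite H" using H by (rule finite_subset) simp
  have finJ: "finite J" using J finH by (rule finite_subset)
  have finB: "finite (B h)" for h
    using finite_verts[OF JE] by (auto simp: B_def intro: finite_subset[of _ "embeddings n J"])
  have lower: "real (card J) - x - real (card H) * N h G \<le> overlap n H h G"
    if h: "h \<in> copies n H" "h \<subseteq> G" for h G
  proof (cases "{f \<in> B h. graph_map f J \<subseteq> G} = {}")
    case True
    let ?C = "{h \<in> copies n H. h \<subseteq> G}"
    have "real (card J) - x \<le> real (card (h \<inter> h'))" if "h' \<in> ?C" for h'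
    proof -
      from that obtain f where f: "f \<in> embeddings n H" "h' = graph_map f H" "h' \<subseteq> G"
        by (auto simp: copies_eq[OF H])
      have "restrict f (verts J) \<in> embeddings n J"
        by (rule restrict_embeddings[OF J f(1)])
      moreover have "graph_map (restrict f (verts J)) J \<subseteq> G"
      proof -
        have "graph_map (restrict f (verts J)) J = graph_map f J"
          by (rule graph_map_cong) simp
        then show ?thesis using graph_map_mono[OF J, of f] f by auto
      qed
      ultimately have "real (card J) - x \<le> real (card {e \<in> J. restrict f (verts J) ` e \<in> h})"
        using True by (auto simp: B_def not_less)
      also have "\<dots> \<le> real (card (h \<inter> h'))"
        unfolding f(2) using card_inter_copy_ge[OF J f(1) finH] by simp
      finally show ?thesis .
    qed
    then have "real (card ?C) * (real (card J) - x) \<le> (\<Sum>h'\<in>?C. real (card (h \<inter> h')))"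
      by (intro sum_bounded_below) auto
    moreover have "card ?C > 0"
      using h by (auto simp: card_gt_0_iff)
    moreover have "N h G = 0"
      unfolding N_def True by simp
    ultimately show ?thesis
      by (simp add: overlap_def le_divide_eq mult.commute)
  next
    case False
    \<comment> \<open>One bad copy already makes the claimed lower bound nonpositive, because
      \<open>card J\<close> is at most \<open>card H\<close>.\<close>
    then have "card {f \<in> B h. graph_map f J \<subseteq> G} \<ge> 1"
      using finB[of h] by (simp add: Suc_le_eq card_gt_0_iff)
    then have "real (card H) * 1 \<le> real (card H) * N h G"
      unfolding N_def by (intro mult_left_mono) auto
    moreover have "real (card J) \<le> real (card H)"
      using J finH by (simp add: card_mono)
    ultimately have "real (card J) - x - real (card H) * N h G \<le> 0"
      using x by simp
    then show ?thesis using overlap_nonneg[of n H h G] by linarith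
  qed
  have "er_mean n p (\<lambda>G. N h (h \<union> G)) \<le> (1 - \<delta>) powr x * (real k + 1) ^ k"
    if h: "h \<in> copies n H" for h
  proof -
    have "er_mean n p (\<lambda>G. N h (h \<union> G)) \<le>
        (1 - \<delta>) powr x * (real (card (verts h)) + 1) ^ card (verts J)"
      unfolding N_def
    proof (rule er_mean_count_le[OF JE copies_subset[OF h]])
      fix f assume f: "f \<in> B h"
      define S where "S = {e \<in> J. f ` e \<in> h}"
      define d where "d = card {v \<in> verts J. f v \<notin> verts h}"
      have SJ: "S \<subseteq> J" by (auto simp: S_def)
      then have cS: "card S \<le> card J" using finJ by (intro card_mono)
      have ax: "x \<le> real (card J - card S)"
        using f cS by (simp add: B_def S_def)
      have "real d \<le> real (card (verts J)) - real (card (verts S))"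
        using card_verts_preimage_le[OF finite_verts[OF JE], of f h]
        unfolding S_def[symmetric] d_def[symmetric] by linarith
      also have "\<dots> \<le> e * real (card J - card S)"
        using U[OF SJ] cS by (simp add: of_nat_diff)
      finally have d: "real d \<le> e * real (card J - card S)" .
      \<comment> \<open>The powers of \<open>n\<close> are paid for by the \<open>d\<close> vertices
        leaving \<open>h\<close>, through \<open>U\<close> applied to the part \<open>S\<close> of
        \<open>J\<close> landing in \<open>h\<close>. The factor \<open>1 - \<delta>\<close>
        survives once for each missing edge, at least \<open>x\<close> times.\<close>
      have "p ^ (card J - card S) \<le> ((1 - \<delta>) * real n powr (- e)) ^ (card J - card S)"
        using p ple by (intro power_mono) auto
      also have "\<dots> = (1 - \<delta>) powr real (card J - card S) *
          real n powr (- (e * real (card J - card S)))"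
        using \<delta> n by (simp add: power_mult_distrib powr_realpow[symmetric] powr_powr)
      also have "\<dots> \<le> (1 - \<delta>) powr x * real n powr (- real d)"
        using \<delta> n ax d by (intro mult_mono powr_mono powr_mono') auto
      also have "real n powr (- real d) = (1 / real n) ^ d"
        using n by (simp add: powr_minus powr_realpow power_one_over divide_inverse power_inverse)
      finally show "p ^ (card J - card {e \<in> J. f ` e \<in> h}) \<le>
          (1 - \<delta>) powr x * (1 / real n) ^ card {v \<in> verts J. f v \<notin> verts h}"
        by (simp add: S_def d_def)
    qed (use p in \<open>auto simp: B_def\<close>)
    also have "\<dots> \<le> (1 - \<delta>) powr x * (real k + 1) ^ k"
      unfolding k_def card_verts_copy[OF h]
      by (intro mult_left_mono power_increasing card_mono verts_mono J finite_verts[OF H]) auto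
    finally show ?thesis .
  qed
  then have PN: "planted_mean n H p N \<le> (1 - \<delta>) powr x * (real k + 1) ^ k"
    by (intro planted_mean_le[OF H])
  have "real (card J) - x - real (card H) * planted_mean n H p N =
      planted_mean n H p (\<lambda>h G. (real (card J) - x) - real (card H) * N h G)"
    by (simp only: planted_mean_diff planted_mean_cmult planted_mean_const[OF H])
  also have "\<dots> \<le> planted_mean n H p (overlap n H)"
    using lower by (intro planted_mean_mono p) auto
  finally show ?thesis
    using mult_left_mono[OF PN, of "real (card H)"] by (simp add: k_def)
qed

subsection \<open>Upper bound on the overlap\<close>

text \<open>Each new vertex has at least \<open>n / k\<close> free values, because at most
  \<open>k - 1\<close> values are taken and \<open>k \<le> n\<close>. Losing a factor
  \<open>k\<close> per vertex is affordable under weak density.\<close>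

lemma card_injective_extensions:
  fixes \<psi> :: "nat \<Rightarrow> nat"
  assumes "finite W" "finite A" "A \<inter> W = {}" "\<psi> \<in> A \<rightarrow>\<^sub>E {1..n}" "inj_on \<psi> A"
    and "card (A \<union> W) \<le> k" "k \<le> n"
  shows "n ^ card W \<le>
    k ^ card W * card {f \<in> A \<union> W \<rightarrow>\<^sub>E {1..n}. inj_on f (A \<union> W) \<and> restrict f A = \<psi>}"
  using assms
proof (induction W)
  case empty
  let ?X = "{f \<in> A \<union> {} \<rightarrow>\<^sub>E {1..n}. inj_on f (A \<union> {}) \<and> restrict f A = \<psi>}"
  have "\<psi> \<in> ?X"
    using empty by (auto simp: PiE_iff extensional_restrict)
  moreover have "finite ?X"
    using empty by (auto intro!: finite_PiE)
  ultimately have "card ?X > 0"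
    by (auto simp only: card_gt_0_iff)
  then show ?case by (simp only: card.empty power_0 mult_1 Suc_le_eq One_nat_def)
next
  case (insert w W)
  define X where "X = {f \<in> A \<union> W \<rightarrow>\<^sub>E {1..n}. inj_on f (A \<union> W) \<and> restrict f A = \<psi>}"
  define X' where "X' = {f \<in> A \<union> insert w W \<rightarrow>\<^sub>E {1..n}.
    inj_on f (A \<union> insert w W) \<and> restrict f A = \<psi>}"
  define Y where "Y = Sigma X (\<lambda>f. {1..n} - f ` (A \<union> W))"
  have w: "w \<notin> A \<union> W" using insert by auto
  have fin: "finite (A \<union> W)" using insert by auto
  have finX: "finite X" "finite X'"
    using insert by (auto simp: X_def X'_def intro!: finite_PiE)
  have card_AW: "card (A \<union> insert w W) = Suc (card (A \<union> W))"
    using w fin by simp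
  then have cardk: "card (A \<union> W) \<le> k - 1" "1 \<le> k" using insert.prems by auto
  have IH: "n ^ card W \<le> k ^ card W * card X"
    unfolding X_def using insert.prems card_AW by (intro insert.IH) auto
  have "card Y \<le> card X'"
  proof (rule card_inj_on_le)
    show "inj_on (\<lambda>(f, x). f(w := x)) Y"
    proof (rule inj_onI, clarify)
      fix f x g y assume *: "(f, x) \<in> Y" "(g, y) \<in> Y" "f(w := x) = g(w := y)"
      \<comment> \<open>Both functions are \<open>undefined\<close> at \<open>w\<close>, so the
        update can be reversed.\<close>
      have "f w = g w"
        using * w by (auto simp: Y_def X_def PiE_iff extensional_def)
      then have "f = g" using *(3) by (metis fun_upd_triv fun_upd_upd)
      moreover have "x = y" using *(3) by (metis fun_upd_same)
      ultimately show "f = g \<and> x = y" by simp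
    qed
    show "(\<lambda>(f, x). f(w := x)) ` Y \<subseteq> X'"
    proof clarify
      fix f x assume "(f, x) \<in> Y"
      then have f: "f \<in> A \<union> W \<rightarrow>\<^sub>E {1..n}" "inj_on f (A \<union> W)" "restrict f A = \<psi>"
        and x: "x \<in> {1..n}" "x \<notin> f ` (A \<union> W)" by (auto simp: Y_def X_def)
      have "f(w := x) \<in> A \<union> insert w W \<rightarrow>\<^sub>E {1..n}"
        using f(1) x(1) by (auto simp: PiE_iff extensional_def)
      moreover have "inj_on (f(w := x)) (A \<union> insert w W)"
        using f(2) x(2) w by (auto simp: inj_on_def)
      moreover have "restrict (f(w := x)) A = \<psi>"
        unfolding f(3)[symmetric] using w by (intro restrict_ext) auto
      ultimately show "f(w := x) \<in> X'" by (simp add: X'_def)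
    qed
  qed (rule finX)
  moreover have "card Y = card X * (n - card (A \<union> W))"
  proof -
    have "card ({1..n} - f ` (A \<union> W)) = n - card (A \<union> W)" if "f \<in> X" for f
    proof -
      have "f ` (A \<union> W) \<subseteq> {1..n}" "card (f ` (A \<union> W)) = card (A \<union> W)"
        using that by (auto simp: X_def card_image)
      then show ?thesis using fin by (subst card_Diff_subset) auto
    qed
    then show ?thesis
      unfolding Y_def using finX by (simp add: card_SigmaI)
  qed
  ultimately have X': "card X * (n - card (A \<union> W)) \<le> card X'" by simp
  \<comment> \<open>With \<open>n = k + b\<close>, at least \<open>b + 1\<close> values remain, and
    \<open>k * (b + 1)\<close> is at least \<open>k + b\<close>.\<close>
  have "n \<le> k * (n - card (A \<union> W))"
  proof -
    obtain a where a: "k = Suc a" using cardk by (cases k) auto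
    obtain b where b: "n = k + b" using insert.prems le_Suc_ex by blast
    have "n \<le> k * Suc b" by (simp add: a b)
    also have "\<dots> \<le> k * (n - card (A \<union> W))"
      using cardk b a by (intro mult_le_mono2) simp
    finally show ?thesis .
  qed
  then have "n ^ card W * n \<le> (k ^ card W * card X) * (k * (n - card (A \<union> W)))"
    using IH by (rule mult_le_mono[rotated])
  also have "\<dots> = k ^ Suc (card W) * (card X * (n - card (A \<union> W)))" by simp
  also have "\<dots> \<le> k ^ Suc (card W) * card X'"
    using X' by (rule mult_le_mono2)
  finally show ?case
    using insert.hyps unfolding X'_def[symmetric] by (simp add: mult.commute)
qed

text \<open>An embedding with image \<open>h\<close> maps \<open>verts H\<close> into
  \<open>verts h\<close>, a set of the same size, so each copy arises from at most
  \<open>k ^ k\<close> embeddings, where \<open>k\<close> is that size.\<close>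

lemma card_embeddings_into_copies:
  assumes H: "H \<subseteq> complete_graph n" and D: "D \<subseteq> copies n H"
  shows "card {f \<in> embeddings n H. graph_map f H \<in> D} \<le> card (verts H) ^ card (verts H) * card D"
proof -
  have finV: "finite (verts H)" by (rule finite_verts[OF H])
  have finD: "finite D" using D by (rule finite_subset) simp
  have "{f \<in> embeddings n H. graph_map f H \<in> D} \<subseteq> (\<Union>h\<in>D. verts H \<rightarrow>\<^sub>E verts h)"
    by (auto simp: embeddings_def verts_graph_map intro!: PiE_I)
  moreover have "finite (verts h)" if "h \<in> D" for h
    using that D by (intro finite_verts[of _ n] copies_subset) auto
  ultimately have "card {f \<in> embeddings n H. graph_map f H \<in> D} \<le> card (\<Union>h\<in>D. verts H \<rightarrow>\<^sub>E verts h)"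
    using finD finV by (intro card_mono) (auto intro!: finite_PiE)
  also have "\<dots> \<le> (\<Sum>h\<in>D. card (verts H \<rightarrow>\<^sub>E verts h))"
    by (rule card_UN_le[OF finD])
  also have "\<dots> = (\<Sum>h\<in>D. card (verts H) ^ card (verts H))"
    using D finV by (intro sum.cong) (auto simp: card_PiE card_verts_copy)
  finally show ?thesis by (simp add: mult.commute)
qed

definition extensions :: "nat \<Rightarrow> graph \<Rightarrow> graph \<Rightarrow> (nat \<Rightarrow> nat) \<Rightarrow> (nat \<Rightarrow> nat) set" where
  "extensions n H J \<psi> = {f \<in> embeddings n H. restrict f (verts J) = \<psi>}"

lemma card_extensions:
  assumes H: "H \<subseteq> complete_graph n" and J: "J \<subseteq> H" and \<psi>: "\<psi> \<in> embeddings n J"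
  defines "k \<equiv> card (verts H)"
  defines "m \<equiv> k - card (verts J)"
  shows "n ^ m \<le> k ^ m * card (extensions n H J \<psi>)"
proof -
  have finV: "finite (verts H)" by (rule finite_verts[OF H])
  have VJ: "verts J \<subseteq> verts H" by (rule verts_mono[OF J])
  then have un: "verts J \<union> (verts H - verts J) = verts H" by auto
  have finJ: "finite (verts J)" using VJ finV by (rule finite_subset)
  have kn: "k \<le> n"
    using card_mono[OF _ verts_complete_graph[OF H]] by (simp add: k_def)
  have m: "card (verts H - verts J) = m"
    using card_Diff_subset[OF finJ VJ] by (simp add: m_def k_def)
  have "extensions n H J \<psi> = {f \<in> verts H \<rightarrow>\<^sub>E {1..n}. inj_on f (verts H) \<and> restrict f (verts J) = \<psi>}"
    by (auto simp: extensions_def embeddings_def)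
  then show ?thesis
    using card_injective_extensions[of "verts H - verts J" "verts J" \<psi> n k] \<psi> finV finJ kn
    unfolding un m by (simp add: k_def embeddings_def)
qed

text \<open>Given the placement \<open>\<psi>\<close> of \<open>J\<close>, the law of the observed graph has a density proportional to
  the number of extensions of \<open>\<psi>\<close> with respect to the law with only \<open>J\<close> planted. Hence this number
  is rarely much smaller than its mean, and no second moment is needed.\<close>

lemma sum_extensions_rare:
  assumes H: "H \<subseteq> complete_graph n" and J: "J \<subseteq> H" and \<psi>: "\<psi> \<in> embeddings n J"
    and p: "0 < p" "p < 1" and \<tau>: "0 \<le> \<tau>"
  defines "Y \<equiv> \<lambda>G. real (card {f \<in> extensions n H J \<psi>. graph_map f H \<subseteq> G})"
  shows "(\<Sum>f\<in>extensions n H J \<psi>. er_mean n p (\<lambda>G. if Y (graph_map f H \<union> G) < \<tau> then 1 else 0)) \<le>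
    \<tau> * p ^ card J / p ^ card H"
proof -
  define E where "E = complete_graph n"
  define j where "j = graph_map \<psi> J"
  define g where "g = (\<lambda>G. if Y G < \<tau> then 1 else (0::real))"
  let ?X = "extensions n H J \<psi>"
  have finX: "finite ?X"
    using finite_verts[OF H]
    by (intro finite_subset[of ?X "embeddings n H"]) (auto simp: extensions_def)
  have JE: "J \<subseteq> complete_graph n" using H J by auto
  have jE: "j \<subseteq> complete_graph n" unfolding j_def by (rule graph_map_subset[OF JE \<psi>])
  have "inj_on \<psi> (verts J)" using \<psi> by (simp add: embeddings_def)
  then have cj: "card j = card J" unfolding j_def by (rule card_graph_map)
  have ext: "graph_map f H \<subseteq> E" "card (graph_map f H) = card H" "j \<subseteq> graph_map f H"
    if "f \<in> ?X" for f
  proof -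
    have f: "f \<in> embeddings n H" "restrict f (verts J) = \<psi>" using that by (auto simp: extensions_def)
    show "graph_map f H \<subseteq> E" unfolding E_def by (rule graph_map_subset[OF H f(1)])
    show "card (graph_map f H) = card H"
      using f by (intro card_graph_map) (simp add: embeddings_def)
    have "j = graph_map f J" unfolding j_def f(2)[symmetric] by (rule graph_map_cong) simp
    then show "j \<subseteq> graph_map f H" using graph_map_mono[OF J] by simp
  qed
  have "(\<Sum>f\<in>?X. er_mean n p (\<lambda>G. g (graph_map f H \<union> G))) =
      (\<Sum>f\<in>?X. (\<Sum>G\<in>Pow E. if graph_map f H \<subseteq> G then er_weight n p G * g G else 0) / p ^ card H)"
    using er_mean_planted[OF _ p(1)] ext by (intro sum.cong) (auto simp: E_def)
  also have "\<dots> = (\<Sum>f\<in>?X. \<Sum>G\<in>Pow E. if graph_map f H \<subseteq> G then er_weight n p G * g G else 0) /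
      p ^ card H"
    by (simp only: sum_divide_distrib)
  also have "(\<Sum>f\<in>?X. \<Sum>G\<in>Pow E. if graph_map f H \<subseteq> G then er_weight n p G * g G else 0) =
      (\<Sum>G\<in>Pow E. \<Sum>f\<in>?X. if graph_map f H \<subseteq> G then er_weight n p G * g G else 0)"
    by (rule sum.swap)
  \<comment> \<open>Exchanging the sums makes the count \<open>Y\<close> itself the density, so the
    event that \<open>Y\<close> is small gets a proportionally small weight.\<close>
  also have "\<dots> = (\<Sum>G\<in>Pow E. er_weight n p G * (Y G * g G))"
    using finX by (simp add: Y_def sum.inter_filter[symmetric] mult_ac)
  also have "\<dots> \<le> (\<Sum>G\<in>Pow E. er_weight n p G * (\<tau> * (if j \<subseteq> G then 1 else 0)))"
  proof (intro sum_mono mult_left_mono er_weight_nonneg p)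
    fix G
    show "Y G * g G \<le> \<tau> * (if j \<subseteq> G then 1 else 0)"
    \<comment> \<open>Every extension of the placement contains \<open>j\<close>, so
      \<open>Y\<close> vanishes unless \<open>j\<close> lies in \<open>G\<close>. This produces the
      factor \<open>p ^ card J\<close>.\<close>
    proof (cases "j \<subseteq> G")
      case False
      then have "{f \<in> ?X. graph_map f H \<subseteq> G} = {}" using ext(3) by blast
      then have "Y G = 0" unfolding Y_def by (simp only: card.empty of_nat_0)
      then show ?thesis using False by simp
    qed (use \<tau> in \<open>auto simp: g_def\<close>)
  qed
  also have "\<dots> = \<tau> * p ^ card j"
    using er_mean_supset[OF jE, of p] er_mean_cmult[of n p \<tau> "\<lambda>G. if j \<subseteq> G then 1 else 0"]
    by (simp only: er_mean_def E_def)
  finally show ?thesis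
    using p by (simp add: g_def cj divide_right_mono)
qed

text \<open>Few copies of \<open>H\<close> mean few extensions of each placement of
  \<open>J\<close>, so \<open>sum_extensions_rare\<close> can be summed over placements. The number
  of placements is then compared with the number of copies by double counting.\<close>

lemma planted_mean_few_copies:
  assumes H: "H \<subseteq> complete_graph n" and J: "J \<subseteq> H" and n: "n \<ge> 1"
    and p: "0 < p" "p < 1" and \<theta>: "0 \<le> \<theta>"
  defines "k \<equiv> card (verts H)"
  defines "m \<equiv> k - card (verts J)"
  shows "planted_mean n H p (\<lambda>_ G. if real (card {h \<in> copies n H. h \<subseteq> G}) < \<theta> then 1 else 0) \<le>
    \<theta> * real (k ^ k) * real (k ^ k) * real (k ^ m) * p ^ card J / (p ^ card H * real n ^ m)"
proof -
  let ?C = "copies n H" and ?M = "embeddings n H" and ?P = "embeddings n J"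
  define g where "g = (\<lambda>G. if real (card {h \<in> ?C. h \<subseteq> G}) < \<theta> then 1 else (0::real))"
  define Y where "Y \<psi> G = real (card {f \<in> extensions n H J \<psi>. graph_map f H \<subseteq> G})" for \<psi> G
  define \<tau> where "\<tau> = \<theta> * real (k ^ k)"
  have finV: "finite (verts H)" by (rule finite_verts[OF H])
  have JE: "J \<subseteq> complete_graph n" using H J by auto
  have finM: "finite ?M" "finite ?P"
    using finV finite_verts[OF JE] by auto
  have Cne: "card ?C > 0"
    using copies_nonempty[OF H] by (simp add: card_gt_0_iff)
  \<comment> \<open>Each copy accounts for at most \<open>k ^ k\<close> embeddings, hence the
    threshold \<open>\<tau>\<close> for extensions.\<close>
  have g_le: "g G \<le> (if Y \<psi> G < \<tau> then 1 else 0)" for \<psi> G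
  proof -
    have "Y \<psi> G \<le> real (card {f \<in> ?M. graph_map f H \<in> {h \<in> ?C. h \<subseteq> G}})"
      unfolding Y_def using finM
      by (intro of_nat_mono card_mono) (auto simp: extensions_def copies_eq[OF H])
    also have "\<dots> \<le> real (k ^ k * card {h \<in> ?C. h \<subseteq> G})"
      unfolding k_def by (intro of_nat_mono card_embeddings_into_copies[OF H]) auto
    finally have le: "Y \<psi> G \<le> real (k ^ k) * real (card {h \<in> ?C. h \<subseteq> G})"
      by simp
    have "Y \<psi> G < \<tau>" if "real (card {h \<in> ?C. h \<subseteq> G}) < \<theta>"
    proof -
      have "k ^ k > 0" by (cases k) auto
      then have "real (k ^ k) * real (card {h \<in> ?C. h \<subseteq> G}) < real (k ^ k) * \<theta>"
        using that by (intro mult_strict_left_mono) auto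
      then show ?thesis using le by (simp add: \<tau>_def mult.commute)
    qed
    then show ?thesis by (auto simp: g_def)
  qed
  have g0: "0 \<le> er_mean n p (\<lambda>G. g (h \<union> G))" for h
    using er_mean_mono[OF p, of n "\<lambda>_. 0"] by (simp add: g_def er_mean_const)
  have split: "sum F ?M = (\<Sum>\<psi>\<in>?P. \<Sum>f\<in>extensions n H J \<psi>. F f)" for F :: "_ \<Rightarrow> real"
    unfolding extensions_def using restrict_embeddings[OF J] finM
    by (intro sum.group[symmetric]) auto
  \<comment> \<open>Summing over embeddings repeats each copy at least once, and the terms are
    nonnegative by \<open>g0\<close>.\<close>
  have "(\<Sum>h\<in>?C. er_mean n p (\<lambda>G. g (h \<union> G))) \<le>
      (\<Sum>f\<in>?M. er_mean n p (\<lambda>G. g (graph_map f H \<union> G)))"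
    unfolding copies_eq[OF H] using finM(1) g0
    by (rule sum_image_le[of ?M "\<lambda>h. er_mean n p (\<lambda>G. g (h \<union> G))", unfolded comp_def])
  also have "\<dots> = (\<Sum>\<psi>\<in>?P. \<Sum>f\<in>extensions n H J \<psi>. er_mean n p (\<lambda>G. g (graph_map f H \<union> G)))"
    by (rule split)
  also have "\<dots> \<le> (\<Sum>\<psi>\<in>?P. \<tau> * p ^ card J / p ^ card H)"
  proof (rule sum_mono)
    fix \<psi> assume \<psi>: "\<psi> \<in> ?P"
    have "(\<Sum>f\<in>extensions n H J \<psi>. er_mean n p (\<lambda>G. g (graph_map f H \<union> G))) \<le>
        (\<Sum>f\<in>extensions n H J \<psi>.
          er_mean n p (\<lambda>G. if Y \<psi> (graph_map f H \<union> G) < \<tau> then 1 else 0))"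
      by (intro sum_mono er_mean_mono p g_le)
    also have "\<dots> \<le> \<tau> * p ^ card J / p ^ card H"
      unfolding Y_def by (rule sum_extensions_rare[OF H J \<psi> p]) (use \<theta> in \<open>simp add: \<tau>_def\<close>)
    finally show "(\<Sum>f\<in>extensions n H J \<psi>. er_mean n p (\<lambda>G. g (graph_map f H \<union> G))) \<le> \<dots>" .
  qed
  also have "\<dots> = real (card ?P) * (\<tau> * p ^ card J / p ^ card H)" by simp
  finally have num: "(\<Sum>h\<in>?C. er_mean n p (\<lambda>G. g (h \<union> G))) \<le>
    real (card ?P) * (\<tau> * p ^ card J / p ^ card H)" .
  \<comment> \<open>Each placement of \<open>J\<close> has at least \<open>(n / k) ^ m\<close>
    extensions, while all embeddings together number at most \<open>k ^ k\<close> per copy.\<close>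
  have "real (card ?P) * real n ^ m = (\<Sum>\<psi>\<in>?P. real (n ^ m))" by simp
  also have "\<dots> \<le> (\<Sum>\<psi>\<in>?P. real (k ^ m * card (extensions n H J \<psi>)))"
    unfolding m_def k_def by (intro sum_mono of_nat_mono card_extensions H J)
  also have "\<dots> = real (k ^ m) * (\<Sum>\<psi>\<in>?P. \<Sum>f\<in>extensions n H J \<psi>. 1)"
    by (simp add: sum_distrib_left)
  also have "\<dots> = real (k ^ m) * real (card ?M)"
    by (subst split[symmetric]) simp
  also have "\<dots> \<le> real (k ^ m) * real (k ^ k * card ?C)"
  proof (intro mult_left_mono of_nat_mono)
    have "?M = {f \<in> ?M. graph_map f H \<in> ?C}" by (auto simp: copies_eq[OF H])
    then show "card ?M \<le> k ^ k * card ?C"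
      using card_embeddings_into_copies[OF H order_refl] by (simp add: k_def)
  qed simp
  finally have den: "real (card ?P) * real n ^ m \<le> real (k ^ m) * real (k ^ k) * real (card ?C)"
    by (simp add: mult_ac)
  define q where "q = \<tau> * p ^ card J / p ^ card H"
  have q: "0 \<le> q" using p \<theta> by (simp add: q_def \<tau>_def)
  have nm: "0 < real n ^ m" using n by simp
  have "planted_mean n H p (\<lambda>_. g) \<le> real (card ?P) * q / real (card ?C)"
    unfolding planted_mean_def using num by (intro divide_right_mono) (auto simp: q_def)
  also have "\<dots> \<le> (real (k ^ m) * real (k ^ k)) * q / real n ^ m"
  proof -
    have "real (card ?P) / real (card ?C) \<le> real (k ^ m) * real (k ^ k) / real n ^ m"
      using den nm Cne by (simp add: divide_le_eq le_divide_eq mult_ac)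
    then have "real (card ?P) / real (card ?C) * q \<le> real (k ^ m) * real (k ^ k) / real n ^ m * q"
      using q by (rule mult_right_mono)
    then show ?thesis by simp
  qed
  also have "\<dots> = \<theta> * real (k ^ k) * real (k ^ k) * real (k ^ m) * p ^ card J /
      (p ^ card H * real n ^ m)"
    by (simp add: q_def \<tau>_def mult_ac)
  finally show ?thesis by (simp add: g_def)
qed

text \<open>\<open>A\<close> is, up to entropy factors, the mean number of copies extending a fixed
  planted copy of \<open>J\<close>. Every edge shared beyond \<open>card J\<close> costs a further
  factor \<open>1 + \<delta>\<close>, so copies with excess above \<open>x\<close> are rarer by
  \<open>(1 + \<delta>) powr (- x)\<close>.\<close>

lemma planted_mean_bad_copies:
  fixes \<delta> x e p :: real
  assumes H: "H \<subseteq> complete_graph n" and J: "J \<subseteq> H" and n: "n \<ge> 1"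
    and p: "0 < p" "p < 1" and \<delta>: "0 < \<delta>" and x: "0 \<le> x"
    and ple: "(1 + \<delta>) * real n powr (- e) \<le> p"
    and L: "\<And>S. S \<subseteq> H \<Longrightarrow>
      e * (real (card S) - real (card J)) \<le> real (card (verts S)) - real (card (verts J))"
  defines "k \<equiv> card (verts H)"
  defines "A \<equiv> p ^ (card H - card J) * real n ^ (k - card (verts J))"
  shows "planted_mean n H p (\<lambda>h G. real (card {f \<in> embeddings n H.
      real (card J) + x < real (card {e \<in> H. f ` e \<in> h}) \<and> graph_map f H \<subseteq> G})) \<le>
    A * (1 + \<delta>) powr (- x) * (real k + 1) ^ k"
proof (rule planted_mean_le[OF H])
  fix h assume h: "h \<in> copies n H"
  define B where "B = {f \<in> embeddings n H. real (card J) + x < real (card {e \<in> H. f ` e \<in> h})}"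
  define m where "m = k - card (verts J)"
  have finH: "finite H" using H by (rule finite_subset) simp
  have finV: "finite (verts H)" by (rule finite_verts[OF H])
  have VJ: "card (verts J) \<le> k"
    unfolding k_def by (intro card_mono finV verts_mono J)
  have "er_mean n p (\<lambda>G. real (card {f \<in> B. graph_map f H \<subseteq> h \<union> G})) \<le>
      A * (1 + \<delta>) powr (- x) * (real (card (verts h)) + 1) ^ card (verts H)"
  proof (rule er_mean_count_le[OF H copies_subset[OF h]])
    fix f assume f: "f \<in> B"
    define S where "S = {e \<in> H. f ` e \<in> h}"
    define d where "d = card {v \<in> verts H. f v \<notin> verts h}"
    define a where "a = card S - card J"
    have SH: "S \<subseteq> H" by (auto simp: S_def)
    then have cS: "card S \<le> card H" using finH by (intro card_mono)
    have Jx: "real (card J) + x < real (card S)" using f by (simp add: B_def S_def)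
    then have JS: "card J \<le> card S" using x by linarith
    then have ax: "x \<le> real a" using Jx by (simp add: a_def of_nat_diff)
    have "e * real a \<le> real (card (verts S)) - real (card (verts J))"
      using L[OF SH] JS by (simp add: a_def of_nat_diff)
    also have "\<dots> \<le> real m - real d"
      using card_verts_preimage_le[OF finV, of f h] VJ
      unfolding S_def[symmetric] d_def[symmetric] k_def[symmetric] m_def by (simp add: of_nat_diff)
    \<comment> \<open>By \<open>L\<close>, sharing \<open>a\<close> extra edges forces at least
      \<open>e * a\<close> extra shared vertices, leaving at most \<open>m - e * a\<close> vertices
      outside \<open>h\<close>.\<close>
    finally have ea: "e * real a \<le> real m - real d" .
    have "(1 + \<delta>) powr x * real n powr (real d - real m) \<le>
        (1 + \<delta>) powr real a * real n powr (- (e * real a))"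
      using \<delta> n ax ea by (intro mult_mono powr_mono) auto
    also have "\<dots> = ((1 + \<delta>) * real n powr (- e)) ^ a"
      using \<delta> n by (simp add: power_mult_distrib powr_realpow[symmetric] powr_powr)
    also have "\<dots> \<le> p ^ a"
      using ple \<delta> by (intro power_mono) auto
    finally have pa: "(1 + \<delta>) powr x * real n powr (real d - real m) \<le> p ^ a" .
    \<comment> \<open>Writing 1 as a product turns the lower bound on \<open>p ^ a\<close> into an
      upper bound on \<open>p ^ (card H - card S)\<close> without dividing by powers of
      \<open>p\<close>.\<close>
    have "1 = ((1 + \<delta>) powr x * real n powr (real d - real m)) *
        (real n ^ m * (1 + \<delta>) powr (- x) * (1 / real n) ^ d)"
      using \<delta> n by (simp add: powr_diff powr_minus powr_realpow power_one_over field_simps)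
    also have "\<dots> \<le> p ^ a * (real n ^ m * (1 + \<delta>) powr (- x) * (1 / real n) ^ d)"
      using pa by (intro mult_right_mono) auto
    finally have "p ^ (card H - card S) * 1 \<le>
        p ^ (card H - card S) * (p ^ a * (real n ^ m * (1 + \<delta>) powr (- x) * (1 / real n) ^ d))"
      using p by (intro mult_left_mono) auto
    also have "\<dots> = A * (1 + \<delta>) powr (- x) * (1 / real n) ^ d"
    proof -
      have "card H - card J = (card H - card S) + a" using cS JS by (simp add: a_def)
      then show ?thesis by (simp add: A_def m_def power_add mult_ac)
    qed
    finally show "p ^ (card H - card {e \<in> H. f ` e \<in> h}) \<le>
        A * (1 + \<delta>) powr (- x) * (1 / real n) ^ card {v \<in> verts H. f v \<notin> verts h}"
      by (simp add: S_def d_def)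
  qed (use p in \<open>auto simp: B_def A_def\<close>)
  then show "er_mean n p (\<lambda>G. real (card {f \<in> embeddings n H.
      real (card J) + x < real (card {e \<in> H. f ` e \<in> h}) \<and> graph_map f H \<subseteq> h \<union> G})) \<le>
    A * (1 + \<delta>) powr (- x) * (real k + 1) ^ k"
    by (simp add: B_def k_def card_verts_copy[OF h] conj_assoc)
qed

text \<open>If \<open>G\<close> has fewer than \<open>\<theta>\<close> copies, the trivial bound
  \<open>card H\<close> is charged to that event. Otherwise good copies contribute at most
  \<open>c + x\<close>, and each bad one at most \<open>card H\<close> divided by at least
  \<open>\<theta>\<close> copies.\<close>

lemma overlap_le:
  fixes \<theta> x c :: real
  assumes H: "H \<subseteq> complete_graph n" and h: "h \<in> copies n H" and \<theta>: "0 < \<theta>"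
    and x: "0 \<le> x" and c: "0 \<le> c"
  shows "overlap n H h G \<le> c + x +
    real (card H) * (if real (card {h \<in> copies n H. h \<subseteq> G}) < \<theta> then 1 else 0) +
    real (card H) / \<theta> * real (card {f \<in> embeddings n H.
      c + x < real (card {e \<in> H. f ` e \<in> h}) \<and> graph_map f H \<subseteq> G})"
    (is "_ \<le> _ + _ * ?g + _ * real (card ?B)")
proof (cases "real (card {h \<in> copies n H. h \<subseteq> G}) < \<theta>")
  case True
  have "0 \<le> real (card H) / \<theta> * real (card ?B)" using \<theta> by simp
  then show ?thesis using overlap_le_card[OF h, of G] c x unfolding if_P[OF True] by linarith
next
  case False
  let ?C = "{h \<in> copies n H. h \<subseteq> G}"
  define z where "z = real (card ?C)"
  have z: "\<theta> \<le> z" "0 < z" using False \<theta> by (simp_all add: z_def)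
  have finh: "finite h" using copies_subset[OF h] by (rule finite_subset) simp
  have finB: "finite ?B"
    using finite_embeddings[OF finite_verts[OF H]] by (rule rev_finite_subset) auto
  \<comment> \<open>Bad copies are images of bad embeddings, so counting embeddings bounds them from
    above.\<close>
  have "{h' \<in> ?C. c + x < real (card (h \<inter> h'))} \<subseteq> (\<lambda>f. graph_map f H) ` ?B"
  proof
    fix h' assume h': "h' \<in> {h' \<in> ?C. c + x < real (card (h \<inter> h'))}"
    then obtain f where f: "f \<in> embeddings n H" "h' = graph_map f H"
      by (auto simp: copies_eq[OF H])
    then have "card (h \<inter> h') = card {e \<in> H. f ` e \<in> h}"
      using card_graph_map_Int[of f H h] by (simp add: embeddings_def Int_commute)
    then show "h' \<in> (\<lambda>f. graph_map f H) ` ?B" using f h' by auto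
  qed
  then have bad: "card {h' \<in> ?C. c + x < real (card (h \<inter> h'))} \<le> card ?B"
    using finB by (rule surj_card_le[rotated])
  have "(\<Sum>h'\<in>?C. real (card (h \<inter> h'))) \<le>
      (\<Sum>h'\<in>?C. (c + x) + (if c + x < real (card (h \<inter> h')) then real (card H) else 0))"
  proof (rule sum_mono)
    fix h'
    have "card (h \<inter> h') \<le> card H"
      using card_copy[OF h] finh by (metis card_mono inf_le1)
    then show "real (card (h \<inter> h')) \<le>
        (c + x) + (if c + x < real (card (h \<inter> h')) then real (card H) else 0)"
      using c x by auto
  qed
  also have "\<dots> = z * (c + x) +
      real (card {h' \<in> ?C. c + x < real (card (h \<inter> h'))}) * real (card H)"
    unfolding sum.distrib z_def by (subst sum.inter_filter[symmetric]) (auto simp: distrib_left)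
  also have "\<dots> \<le> z * (c + x) + real (card ?B) * real (card H)"
    using bad by (intro add_left_mono mult_right_mono) auto
  finally have "overlap n H h G \<le> (z * (c + x) + real (card ?B) * real (card H)) / z"
    unfolding overlap_def z_def[symmetric] using z by (intro divide_right_mono) auto
  also have "\<dots> = c + x + real (card H) * real (card ?B) / z"
    using z by (simp add: add_divide_distrib mult.commute)
  also have "\<dots> \<le> c + x + real (card H) * real (card ?B) / \<theta>"
    using z \<theta> by (intro add_left_mono divide_left_mono) auto
  finally show ?thesis using False by simp
qed

lemma planted_mean_overlap_le:
  fixes \<delta> x e p :: real
  assumes H: "H \<subseteq> complete_graph n" and J: "J \<subseteq> H" and n: "n \<ge> 1"
    and p: "0 < p" "p < 1" and \<delta>: "0 < \<delta>" and x: "0 \<le> x"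
    and ple: "(1 + \<delta>) * real n powr (- e) \<le> p"
    and L: "\<And>S. S \<subseteq> H \<Longrightarrow>
      e * (real (card S) - real (card J)) \<le> real (card (verts S)) - real (card (verts J))"
  defines "k \<equiv> card (verts H)"
  shows "planted_mean n H p (overlap n H) \<le> real (card J) + x +
    real (card H) * (2 * ((1 + \<delta>) powr (- x / 2) * (real k + 1) ^ (3 * k)))"
proof -
  define m where "m = k - card (verts J)"
  define A where "A = p ^ (card H - card J) * real n ^ m"
  define s where "s = (1 + \<delta>) powr (- x / 2)"
  \<comment> \<open>The threshold is the geometric mean of \<open>A\<close> and the bad-copy scale
    \<open>A * s * s\<close>. Both the chance of fewer than \<open>\<theta>\<close> copies and the
    mean fraction of bad ones are then of order \<open>s\<close>.\<close>
  define \<theta> where "\<theta> = A * s"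
  let ?g = "\<lambda>_ G. if real (card {h \<in> copies n H. h \<subseteq> G}) < \<theta> then 1 else (0::real)"
  let ?N = "\<lambda>h G. real (card {f \<in> embeddings n H.
      real (card J) + x < real (card {e \<in> H. f ` e \<in> h}) \<and> graph_map f H \<subseteq> G})"
  have finH: "finite H" using H by (rule finite_subset) simp
  have JH: "card J \<le> card H" by (rule card_mono[OF finH J])
  have pos: "0 < A" "0 < s" "0 < \<theta>"
    using p n \<delta> by (auto simp: A_def s_def \<theta>_def)
  have ss: "(1 + \<delta>) powr (- x) = s * s"
    unfolding s_def using powr_add[of "1 + \<delta>" "- x / 2" "- x / 2"] by simp
  have kk: "real (k ^ i) \<le> (real k + 1) ^ k" if "i \<le> k" for i
  proof -
    have "real (k ^ i) \<le> (real k + 1) ^ i" by (simp add: power_mono)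
    also have "\<dots> \<le> (real k + 1) ^ k" using that by (intro power_increasing) auto
    finally show ?thesis .
  qed
  have "planted_mean n H p ?g \<le>
      \<theta> * real (k ^ k) * real (k ^ k) * real (k ^ m) * p ^ card J / (p ^ card H * real n ^ m)"
    unfolding k_def m_def using pos by (intro planted_mean_few_copies H J n p) auto
  also have "\<dots> = s * (real (k ^ k) * real (k ^ k) * real (k ^ m))"
  proof -
    have "p ^ card H = p ^ (card H - card J) * p ^ card J"
      using JH by (simp add: power_add[symmetric])
    then show ?thesis using p n by (simp add: \<theta>_def A_def)
  qed
  \<comment> \<open>The three entropy factors from the counting of copies give the exponent
    \<open>3 * k\<close>.\<close>
  also have "\<dots> \<le> s * ((real k + 1) ^ k * (real k + 1) ^ k * (real k + 1) ^ k)"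
    using pos kk by (intro mult_left_mono mult_mono) (auto simp: m_def)
  also have "\<dots> = s * (real k + 1) ^ (3 * k)"
    by (simp add: power_mult power3_eq_cube power_mult_distrib mult_ac)
  finally have g: "planted_mean n H p ?g \<le> s * (real k + 1) ^ (3 * k)" .
  have "planted_mean n H p ?N \<le> A * (1 + \<delta>) powr (- x) * (real k + 1) ^ k"
    unfolding A_def m_def k_def by (rule planted_mean_bad_copies[OF H J n p \<delta> x ple L])
  also have "\<dots> = \<theta> * (s * (real k + 1) ^ k)"
    by (simp add: ss \<theta>_def mult_ac)
  also have "\<dots> \<le> \<theta> * (s * (real k + 1) ^ (3 * k))"
    using pos by (intro mult_left_mono power_increasing) auto
  finally have N: "planted_mean n H p ?N \<le> \<theta> * (s * (real k + 1) ^ (3 * k))" .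
  have "planted_mean n H p (overlap n H) \<le> planted_mean n H p (\<lambda>h G.
      (real (card J) + x) + real (card H) * ?g h G + real (card H) / \<theta> * ?N h G)"
    using overlap_le[OF H _ pos(3) x] by (intro planted_mean_mono p) auto
  also have "\<dots> = (real (card J) + x) + real (card H) * planted_mean n H p ?g +
      real (card H) / \<theta> * planted_mean n H p ?N"
    by (simp only: planted_mean_add planted_mean_cmult planted_mean_const[OF H])
  also have "\<dots> \<le> (real (card J) + x) + real (card H) * (s * (real k + 1) ^ (3 * k)) +
      real (card H) / \<theta> * (\<theta> * (s * (real k + 1) ^ (3 * k)))"
    using g N pos by (intro add_mono mult_left_mono) auto
  also have "\<dots> = real (card J) + x + real (card H) * (2 * (s * (real k + 1) ^ (3 * k)))"
    using pos by simp
  finally show ?thesis by (simp add: s_def)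
qed

subsection \<open>Asymptotics\<close>

text \<open>The polynomial factor is \<open>exp\<close> of a multiple of \<open>k ln k\<close>, with
  \<open>k\<close> the number of vertices. Weak density lets half of the exponential decay in the
  number of edges absorb it, and the other half tends to 0.\<close>

lemma weakly_dense_decay:
  fixes r \<epsilon> :: real
  assumes wd: "weakly_dense H" and r: "0 < r" "r < 1" and \<epsilon>: "0 < \<epsilon>"
  shows "(\<lambda>n. r powr (\<epsilon> * real (card (H n))) *
    (real (card (verts (H n))) + 1) ^ (c * card (verts (H n)))) \<longlonglongrightarrow> 0"
proof -
  define y k where "y n = real (card (H n))" and "k n = card (verts (H n))" for n
  define z where "z n = real (k n) * ln (real (k n))" for n
  define a where "a = - \<epsilon> * ln r"
  have a: "0 < a" using r \<epsilon> by (simp add: a_def mult_pos_neg)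
  \<comment> \<open>One edge gives two vertices, which keeps \<open>z n\<close> at least 1; this is
    needed for division by \<open>z n\<close> and for the divergence of \<open>y\<close>.\<close>
  have k2: "k n \<ge> 2" if "n \<ge> 2" for n
  proof -
    have sub: "H n \<subseteq> complete_graph n" and "H n \<noteq> {}" using wd that by (auto simp: weakly_dense_def)
    then obtain e where e: "e \<in> H n" by auto
    then have "card e = 2" using sub by (auto simp: complete_graph_def)
    then show ?thesis
      using card_mono[OF finite_verts[OF sub] edge_subset_verts[OF e]] by (simp add: k_def)
  qed
  have ratio: "\<forall>\<^sub>F n in sequentially. y n \<ge> K * z n \<and> z n \<ge> 1" for K
  proof -
    have "liminf (\<lambda>n. ereal (y n / z n)) = \<infinity>"
      using wd by (simp add: weakly_dense_def y_def z_def k_def)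
    then have "ereal K < liminf (\<lambda>n. ereal (y n / z n))" by simp
    then have "\<forall>\<^sub>F n in sequentially. ereal K < ereal (y n / z n)"
      by (rule less_LiminfD)
    then show ?thesis using eventually_ge_at_top[of 2]
    proof eventually_elim
      case (elim n)
      have k: "2 \<le> real (k n)" using k2[OF elim(2)] by linarith
      then have "ln 2 \<le> ln (real (k n))" by simp
      then have "1 / 2 \<le> ln (real (k n))" using ln2_ge_two_thirds by linarith
      with k have "2 * (1 / 2) \<le> z n" unfolding z_def by (rule mult_mono) simp_all
      then show ?case using elim(1) by (simp add: less_divide_eq)
    qed
  qed
  have ytop: "filterlim y at_top sequentially"
    unfolding filterlim_at_top_ge[where c=0]
  proof (intro allI impI)
    fix K :: real assume "0 \<le> K"
    show "\<forall>\<^sub>F n in sequentially. K \<le> y n"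
      using ratio[of K]
    proof eventually_elim
      case (elim n)
      have "K * 1 \<le> K * z n" using elim \<open>0 \<le> K\<close> by (intro mult_left_mono) auto
      then show ?case using elim by simp
    qed
  qed
  have "filterlim (\<lambda>n. a / 2 * y n) at_top sequentially"
    by (rule filterlim_tendsto_pos_mult_at_top[OF tendsto_const _ ytop]) (use a in simp)
  then have lim: "(\<lambda>n. exp (- (a / 2 * y n))) \<longlonglongrightarrow> 0"
    by (intro filterlim_compose[OF exp_at_bot] filterlim_compose[OF filterlim_uminus_at_bot_at_top])
  show ?thesis
  proof (rule tendsto_sandwich[OF _ _ tendsto_const lim])
    show "\<forall>\<^sub>F n in sequentially. r powr (\<epsilon> * real (card (H n))) *
        (real (card (verts (H n))) + 1) ^ (c * card (verts (H n))) \<le> exp (- (a / 2 * y n))"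
      \<comment> \<open>This constant makes \<open>2 * c * z n\<close> at most
        \<open>a / 2 * y n\<close>.\<close>
      using ratio[of "4 * real c / a"] eventually_ge_at_top[of 2]
    proof eventually_elim
      case (elim n)
      have k: "2 \<le> real (k n)" using k2[OF elim(2)] by linarith
      then have "2 * real (k n) \<le> real (k n) ^ 2"
        unfolding power2_eq_square by (rule mult_right_mono) simp
      then have "real (k n) + 1 \<le> real (k n) ^ 2" using k by linarith
      also have "\<dots> = exp (2 * ln (real (k n)))"
        using k by (simp add: exp_double)
      finally have "(real (k n) + 1) ^ (c * k n) \<le> exp (2 * ln (real (k n))) ^ (c * k n)"
        by (intro power_mono) auto
      also have "\<dots> = exp (2 * real c * z n)"
        by (simp add: exp_of_nat_mult[symmetric] z_def mult_ac)
      finally have 1: "(real (k n) + 1) ^ (c * k n) \<le> exp (2 * real c * z n)" .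
      have "r powr (\<epsilon> * y n) = exp (- (a * y n))"
        using r by (simp add: powr_def a_def mult_ac)
      then have "r powr (\<epsilon> * y n) * (real (k n) + 1) ^ (c * k n) \<le>
          exp (- (a * y n)) * exp (2 * real c * z n)"
        using 1 by simp
      also have "\<dots> = exp (2 * real c * z n - a * y n)"
        by (simp add: exp_add[symmetric])
      also have "\<dots> \<le> exp (- (a / 2 * y n))"
        using elim(1) a by (simp add: field_simps)
      finally show ?case by (simp add: y_def k_def)
    qed
  qed (use r in auto)
qed

lemma tendsto_zero_eps:
  fixes D :: "nat \<Rightarrow> real"
  assumes "\<And>\<epsilon>. \<epsilon> > 0 \<Longrightarrow> \<exists>u. u \<longlonglongrightarrow> 0 \<and> (\<forall>\<^sub>F n in sequentially. \<bar>D n\<bar> \<le> \<epsilon> + u n)"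
  shows "D \<longlonglongrightarrow> 0"
  unfolding tendsto_iff dist_real_def
proof (intro allI impI)
  fix \<epsilon> :: real assume "\<epsilon> > 0"
  then obtain u where u: "u \<longlonglongrightarrow> 0" "\<forall>\<^sub>F n in sequentially. \<bar>D n\<bar> \<le> \<epsilon> / 2 + u n"
    using assms[of "\<epsilon> / 2"] by auto
  have "\<forall>\<^sub>F n in sequentially. u n < \<epsilon> / 2"
    using order_tendstoD(2)[OF u(1), of "\<epsilon> / 2"] \<open>\<epsilon> > 0\<close> by simp
  with u(2) show "\<forall>\<^sub>F n in sequentially. \<bar>D n - 0\<bar> < \<epsilon>"
    by eventually_elim simp
qed

lemma MMSE_le:
  fixes \<delta> \<epsilon> p :: real
  assumes H: "H \<subseteq> complete_graph n" "H \<noteq> {}" and n: "n \<ge> 1" and t: "t \<le> onion_length H"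
    and p: "0 < p" "p < 1" and \<delta>: "0 < \<delta>" "\<delta> < 1" and \<epsilon>: "0 \<le> \<epsilon>"
    and ple: "p \<le> (1 - \<delta>) * real n powr (- onion_exponent H t)"
  shows "MMSE n H p - (1 - real (card (onion H t)) / real (card H)) \<le>
    \<epsilon> + (1 - \<delta>) powr (\<epsilon> * real (card H)) * (real (card (verts H)) + 1) ^ card (verts H)"
proof -
  let ?u = "(1 - \<delta>) powr (\<epsilon> * real (card H)) * (real (card (verts H)) + 1) ^ card (verts H)"
  have finH: "finite H" using H(1) by (rule finite_subset) simp
  then have pos: "0 < real (card H)" using H(2) by (simp add: card_gt_0_iff)
  have "real (card (onion H t)) - \<epsilon> * real (card H) - real (card H) * ?u \<le>
      planted_mean n H p (overlap n H)"
    using \<epsilon> by (intro planted_mean_overlap_ge[OF H(1) onion_subset(1)[OF finH] n p \<delta> _ ple]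
      onion_upper finH finite_verts[OF H(1)] t) auto
  then have "(real (card (onion H t)) - \<epsilon> * real (card H) - real (card H) * ?u) / real (card H) \<le>
      planted_mean n H p (overlap n H) / real (card H)"
    by (rule divide_right_mono) simp
  then show ?thesis
    unfolding MMSE_eq[OF H p] using pos by (simp add: diff_divide_distrib)
qed

text \<open>The counterpart with the same slack; \<open>t\<close> is strictly below the length
  because the exponent of the next layer enters.\<close>

lemma MMSE_ge:
  fixes \<delta> \<epsilon> p :: real
  assumes H: "H \<subseteq> complete_graph n" "H \<noteq> {}" and n: "n \<ge> 1" and t: "t < onion_length H"
    and p: "0 < p" "p < 1" and \<delta>: "0 < \<delta>" and \<epsilon>: "0 \<le> \<epsilon>"
    and ple: "(1 + \<delta>) * real n powr (- onion_exponent H (Suc t)) \<le> p"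
  shows "MMSE n H p - (1 - real (card (onion H t)) / real (card H)) \<ge>
    - (\<epsilon> + 2 * ((1 + \<delta>) powr (- (\<epsilon> * real (card H)) / 2) *
      (real (card (verts H)) + 1) ^ (3 * card (verts H))))"
proof -
  let ?u = "2 * ((1 + \<delta>) powr (- (\<epsilon> * real (card H)) / 2) *
      (real (card (verts H)) + 1) ^ (3 * card (verts H)))"
  have finH: "finite H" using H(1) by (rule finite_subset) simp
  then have pos: "0 < real (card H)" using H(2) by (simp add: card_gt_0_iff)
  have "planted_mean n H p (overlap n H) \<le>
      real (card (onion H t)) + \<epsilon> * real (card H) + real (card H) * ?u"
    using \<epsilon> by (intro planted_mean_overlap_le[OF H(1) onion_subset(1)[OF finH] n p \<delta> _ ple]
      onion_lower finH finite_verts[OF H(1)] t) auto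
  then have "planted_mean n H p (overlap n H) / real (card H) \<le>
      (real (card (onion H t)) + \<epsilon> * real (card H) + real (card H) * ?u) / real (card H)"
    by (rule divide_right_mono) simp
  then show ?thesis
    unfolding MMSE_eq[OF H p] using pos by (simp add: add_divide_distrib)
qed

lemma MMSE_nonneg: "0 \<le> MMSE n H p"
  unfolding MMSE_def by (intro mult_nonneg_nonneg integral_nonneg_AE) (auto intro!: sum_nonneg)

theorem corollary3p8:
  fixes H :: "nat \<Rightarrow> graph"
  assumes "weakly_dense H"
  shows "(\<forall>t :: nat \<Rightarrow> nat.
            (\<forall>\<^sub>F n in sequentially. t n < onion_length (H n)) \<longrightarrow>
            (\<exists>c>0. \<forall>\<^sub>F n in sequentially.
               onion_exponent (H n) (t n + 1) - onion_exponent (H n) (t n) \<ge> c / ln (real n)) \<longrightarrow>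
            (\<forall>\<delta>>0. \<forall>p :: nat \<Rightarrow> real.
               (\<forall>\<^sub>F n in sequentially. 0 < p n \<and> p n < 1 \<and>
                  (1 + \<delta>) * real n powr (- onion_exponent (H n) (t n + 1)) \<le> p n \<and>
                  p n \<le> (1 - \<delta>) * real n powr (- onion_exponent (H n) (t n))) \<longrightarrow>
               (\<lambda>n. MMSE n (H n) (p n)
                      - (1 - real (card (onion (H n) (t n))) / real (card (H n))))
                 \<longlonglongrightarrow> 0)) \<and>
         (\<forall>\<delta>>0. \<forall>p :: nat \<Rightarrow> real.
            (\<forall>\<^sub>F n in sequentially. 0 < p n \<and> p n < 1 \<and>
               p n \<le> (1 - \<delta>) * real n powr (- onion_exponent (H n) (onion_length (H n)))) \<longrightarrow>
            (\<lambda>n. MMSE n (H n) (p n)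
                   - (1 - real (card (onion (H n) (onion_length (H n)))) / real (card (H n))))
              \<longlonglongrightarrow> 0 \<and>
            (\<lambda>n. MMSE n (H n) (p n)) \<longlonglongrightarrow> 0)"
proof (intro conjI allI impI)
  define u where "u \<delta> \<epsilon> n = (1 - \<delta>) powr (\<epsilon> * real (card (H n))) *
    (real (card (verts (H n))) + 1) ^ card (verts (H n))" for \<delta> \<epsilon> :: real and n
  define v where "v \<delta> \<epsilon> n = 2 * ((1 + \<delta>) powr (- (\<epsilon> * real (card (H n))) / 2) *
    (real (card (verts (H n))) + 1) ^ (3 * card (verts (H n))))" for \<delta> \<epsilon> :: real and n
  have u: "u \<delta> \<epsilon> \<longlonglongrightarrow> 0" if "0 < \<delta>" "\<delta> < 1" "0 < \<epsilon>" for \<delta> \<epsilon> :: real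
    using weakly_dense_decay[OF assms, of "1 - \<delta>" \<epsilon> 1] that unfolding u_def by simp
  have v: "v \<delta> \<epsilon> \<longlonglongrightarrow> 0" if "0 < \<delta>" "0 < \<epsilon>" for \<delta> \<epsilon> :: real
  proof -
    \<comment> \<open>Rewriting with a base below 1 brings the second error term into the form
      required by \<open>weakly_dense_decay\<close>.\<close>
    have "(1 + \<delta>) powr (- y / 2) = inverse (1 + \<delta>) powr (1 / 2 * y)" for y
      using that by (simp add: powr_minus inverse_powr[symmetric])
    then have "v \<delta> \<epsilon> = (\<lambda>n. 2 * (inverse (1 + \<delta>) powr (\<epsilon> / 2 * real (card (H n))) *
        (real (card (verts (H n))) + 1) ^ (3 * card (verts (H n)))))"
      unfolding v_def by (intro ext) simp
    moreover have "(\<lambda>n. 2 * (inverse (1 + \<delta>) powr (\<epsilon> / 2 * real (card (H n))) *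
        (real (card (verts (H n))) + 1) ^ (3 * card (verts (H n))))) \<longlonglongrightarrow> 2 * 0"
      using that by (intro tendsto_mult_left weakly_dense_decay[OF assms])
        (auto simp: inverse_less_1_iff)
    ultimately show ?thesis by (simp only: mult_zero_right)
  qed
  have H: "H n \<subseteq> complete_graph n" "n \<ge> 2 \<Longrightarrow> H n \<noteq> {}" for n
    using assms by (auto simp: weakly_dense_def)
  \<comment> \<open>The theorem allows any positive \<open>\<delta>\<close>, but for
    \<open>\<delta> \<ge> 1\<close> the upper bound on \<open>p\<close> would contradict
    \<open>p > 0\<close>.\<close>
  have less_1: "\<delta> < 1" if ev: "\<forall>\<^sub>F n in sequentially. 0 < p n \<and> p n \<le> (1 - \<delta>) * real n powr e n"
    for \<delta> :: real and p e
  proof -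
    obtain n where "0 < p n" "p n \<le> (1 - \<delta>) * real n powr e n"
      using eventually_happens'[OF _ ev] by auto
    then have "0 < (1 - \<delta>) * real n powr e n" by linarith
    then show ?thesis by (simp add: zero_less_mult_iff)
  qed
  {
    fix t :: "nat \<Rightarrow> nat" and \<delta> :: real and p :: "nat \<Rightarrow> real"
    assume t: "\<forall>\<^sub>F n in sequentially. t n < onion_length (H n)" and \<delta>: "0 < \<delta>"
      and p: "\<forall>\<^sub>F n in sequentially. 0 < p n \<and> p n < 1 \<and>
        (1 + \<delta>) * real n powr (- onion_exponent (H n) (t n + 1)) \<le> p n \<and>
        p n \<le> (1 - \<delta>) * real n powr (- onion_exponent (H n) (t n))"
    have \<delta>1: "\<delta> < 1"
      by (rule less_1[of p _ "\<lambda>n. - onion_exponent (H n) (t n)"])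
        (use p in \<open>eventually_elim, simp\<close>)
    show "(\<lambda>n. MMSE n (H n) (p n)
        - (1 - real (card (onion (H n) (t n))) / real (card (H n)))) \<longlonglongrightarrow> 0"
    proof (rule tendsto_zero_eps)
      fix \<epsilon> :: real assume \<epsilon>: "0 < \<epsilon>"
      have "\<forall>\<^sub>F n in sequentially. \<bar>MMSE n (H n) (p n)
          - (1 - real (card (onion (H n) (t n))) / real (card (H n)))\<bar> \<le> \<epsilon> + (u \<delta> \<epsilon> n + v \<delta> \<epsilon> n)"
        using t p eventually_ge_at_top[of 2]
      proof eventually_elim
        case (elim n)
        have "0 \<le> u \<delta> \<epsilon> n" "0 \<le> v \<delta> \<epsilon> n" by (simp_all add: u_def v_def)
        moreover have "MMSE n (H n) (p n) - (1 - real (card (onion (H n) (t n))) / real (card (H n)))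
            \<le> \<epsilon> + u \<delta> \<epsilon> n"
          unfolding u_def using elim \<delta> \<delta>1 \<epsilon> H by (intro MMSE_le) auto
        moreover have "MMSE n (H n) (p n) - (1 - real (card (onion (H n) (t n))) / real (card (H n)))
            \<ge> - (\<epsilon> + v \<delta> \<epsilon> n)"
          unfolding v_def using elim \<delta> \<epsilon> H by (intro MMSE_ge) auto
        ultimately show ?case by linarith
      qed
      moreover have "(\<lambda>n. u \<delta> \<epsilon> n + v \<delta> \<epsilon> n) \<longlonglongrightarrow> 0"
        using tendsto_add[OF u v] \<delta> \<delta>1 \<epsilon> by simp
      ultimately show "\<exists>w. w \<longlonglongrightarrow> 0 \<and> (\<forall>\<^sub>F n in sequentially. \<bar>MMSE n (H n) (p n)
          - (1 - real (card (onion (H n) (t n))) / real (card (H n)))\<bar> \<le> \<epsilon> + w n)"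
        by blast
    qed
  }
  fix \<delta> :: real and p :: "nat \<Rightarrow> real"
  assume \<delta>: "0 < \<delta>"
    and p: "\<forall>\<^sub>F n in sequentially. 0 < p n \<and> p n < 1 \<and>
      p n \<le> (1 - \<delta>) * real n powr (- onion_exponent (H n) (onion_length (H n)))"
  have \<delta>1: "\<delta> < 1"
    by (rule less_1[of p _ "\<lambda>n. - onion_exponent (H n) (onion_length (H n))"])
      (use p in \<open>eventually_elim, simp\<close>)
  \<comment> \<open>For \<open>n < 2\<close> the graph is empty and the quotient is
    \<open>0 / 0 = 0\<close>, so this holds only eventually.\<close>
  have ratio: "1 - real (card (onion (H n) (onion_length (H n)))) / real (card (H n)) = 0"
    if "n \<ge> 2" for n
    using H[of n] that finite_subset[OF H(1)[of n]] by (simp add: onion_terminates)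
  show *: "(\<lambda>n. MMSE n (H n) (p n)) \<longlonglongrightarrow> 0"
  proof (rule tendsto_zero_eps)
    fix \<epsilon> :: real assume \<epsilon>: "0 < \<epsilon>"
    have "\<forall>\<^sub>F n in sequentially. \<bar>MMSE n (H n) (p n)\<bar> \<le> \<epsilon> + u \<delta> \<epsilon> n"
      using p eventually_ge_at_top[of 2]
    proof eventually_elim
      case (elim n)
      have "MMSE n (H n) (p n) -
          (1 - real (card (onion (H n) (onion_length (H n)))) / real (card (H n))) \<le> \<epsilon> + u \<delta> \<epsilon> n"
        unfolding u_def using elim \<delta> \<delta>1 \<epsilon> H by (intro MMSE_le) auto
      \<comment> \<open>At the last layer the target is 0, so nonnegativity of the MMSE supplies the
        lower bound.\<close>
      then show ?case
        using ratio[OF elim(2)] MMSE_nonneg[of n "H n" "p n"] by linarith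
    qed
    then show "\<exists>w. w \<longlonglongrightarrow> 0 \<and> (\<forall>\<^sub>F n in sequentially. \<bar>MMSE n (H n) (p n)\<bar> \<le> \<epsilon> + w n)"
      using u[OF \<delta> \<delta>1 \<epsilon>] by blast
  qed
  show "(\<lambda>n. MMSE n (H n) (p n)
      - (1 - real (card (onion (H n) (onion_length (H n)))) / real (card (H n)))) \<longlonglongrightarrow> 0"
    by (rule Lim_transform_eventually[OF *])
      (use eventually_ge_at_top[of 2] in \<open>eventually_elim, simp only: ratio diff_0_right\<close>)
qed

end
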